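(* Let $\lambda\in P$ and $u\in\hat W^0$. Then: (1) $e^\lambda\bullet\psi^u=[\mathcal L_\lambda]\cup\psi^u$; (2) for $i\in I$, $y_i\bullet\psi^u=\psi^u$ and $s_i\bullet\psi^u=\psi^u$; (3) if $u\neq\mathrm{id}$, then $$y_0\bullet\psi^u=\psi^{us_0}=\sum_{\substack{(x_1,x_2)\in\hat W\times W\\ x_1*x_2=us_0}}(-1)^{\ell(x_1)+\ell(x_2)-\ell(u)-1}\,\theta(\psi^{x_1})\cup\eta(\psi^{x_2});$$ (4) if $u\neq\mathrm{id}$, then $$s_0\bullet\psi^u=e^{-\theta}\psi^u+\sum_{\substack{(x_1,x_2)\in\hat W\times W\\ x_1*x_2=us_0}}(-1)^{\ell(x_1)+\ell(x_2)-\ell(u)-1}\,\theta(\psi^{x_1})\cup\eta\big((1-e^{-\theta})\bullet\psi^{x_2}\big).$$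
   Context: $G$ is a complex semisimple simply-connected group with maximal torus $T$, weight lattice $P$, finite node set $I$, highest root $\theta$, maximal compact $K$, $T_{\mathbb R}=K\cap T$; $R(T)=\mathbb Z[P]$. $W$ is the finite Weyl group, $\hat W=Q^\vee\rtimes W$ the affine Weyl group with simple reflections $s_i$ ($i\in I\cup\{0\}$), acting on $R(T)$ at level zero ($s_0$ acts as $s_\theta$), with length $\ell$; $\hat W^0$ is the set of minimal-length coset representatives of $\hat W/W$. Demazure product $*$: associative with $s_i*v=s_iv$ if $s_iv>v$ and $v$ otherwise. Localization identifies $K_T^*(\hat{\mathrm{Fl}})$ with functions $\hat W\to R(T)$; the $K$-nilHecke ring $\hat{\mathbb K}$ (generated in $\mathrm{Frac}(R(T))\#\mathbb Q[\hat W]$ by $R(T)$ and $T_i=(1-e^{\alpha_i})^{-1}(s_i-1)$) pairs with it via $\langle\sum a_ww,\psi\rangle=\sum a_w\psi(w)$ and acts by $(a\bullet\psi)(b)=\langle ba,\psi\rangle$. $y_i:=1+T_i$. $\psi^w$ is the Schubert basis ($\langle T_v,\psi^w\rangle=\delta_{vw}$). $[\mathcal L_\lambda]$ is the line bundle class with $[\mathcal L_\lambda](t_\mu v)=e^{v\lambda}$. $\theta$ (as an operator) is the pullback along $LK/T_{\mathbb R}\to LK/K\simeq\Omega K\hookrightarrow LK\to LK/T_{\mathbb R}$, and $\eta$ the pullback along $LK/T_{\mathbb R}\xrightarrow{\mathrm{ev}_1}K/T_{\mathbb R}\hookrightarrow LK/T_{\mathbb R}$ (evaluation at the identity, then inclusion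 of constant loops). In (4), $e^{-\theta}$ denotes the character of the negative highest root.
   Formalization: In (4) the term e^{-θ}ψ^u is taken as e^{-θ}•ψ^u (= [L_{-θ}]∪ψ^u), since plain multiplication by e^{-θ} fails already for SL_2, u = s_0; G is taken simple so that θ and s_0 are defined; the operators θ, η are given by their values at T-fixed points. *)

theory Defs
  imports "HOL-Library.Poly_Mapping" "HOL-Computational_Algebra.Fraction_Field" Complex_Main
begin

text \<open>The node set I is a finite type 'n (the linorder class is only a technical device
 making Z[P] an integral domain in the library).  Weights P are written in the basis of
 fundamental weights, coroots Q^vee in the basis of simple coroots; both are 'n =>0 int.
 Since G is simply connected, P = Hom(Q^vee, Z) with the pairing below.\<close>

type_synonym 'n lat = "'n \<Rightarrow>\<^sub>0 int"
type_synonym 'n rep = "'n lat \<Rightarrow>\<^sub>0 int"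
type_synonym 'n frac = "'n rep fract"
type_synonym 'n aff = "('n lat \<Rightarrow> 'n lat) \<times> ('n lat \<Rightarrow> 'n lat) \<times> 'n lat"
  (* (level-zero action on P, linear action on Q^vee, translation part in Q^vee) *)

definition lsc :: "int \<Rightarrow> 'n::{finite,linorder} lat \<Rightarrow> 'n lat" where
  "lsc c v = (\<Sum>k\<in>UNIV. Poly_Mapping.single k (c * Poly_Mapping.lookup v k))"

definition lpair :: "'n::{finite,linorder} lat \<Rightarrow> 'n lat \<Rightarrow> int" where
  "lpair \<mu> la = (\<Sum>i\<in>UNIV. Poly_Mapping.lookup \<mu> i * Poly_Mapping.lookup la i)"

definition unitv :: "'n::{finite,linorder} \<Rightarrow> 'n lat" where
  "unitv i = Poly_Mapping.single i 1"

definition echar :: "'n::{finite,linorder} lat \<Rightarrow> 'n rep" where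
  "echar la = Poly_Mapping.single la 1"

definition fr :: "'n::{finite,linorder} rep \<Rightarrow> 'n frac" where
  "fr r = Fraction_Field.Fract r 1"

definition cartan_finite :: "('n::{finite,linorder} \<Rightarrow> 'n \<Rightarrow> int) \<Rightarrow> bool" where
  "cartan_finite A \<longleftrightarrow> (\<forall>i. A i i = 2) \<and> (\<forall>i j. i \<noteq> j \<longrightarrow> A i j \<le> 0)
     \<and> (\<forall>i j. A i j = 0 \<longleftrightarrow> A j i = 0)
     \<and> (\<exists>d::'n \<Rightarrow> real. (\<forall>i. d i > 0) \<and> (\<forall>i j. d i * A i j = d j * A j i)
          \<and> (\<forall>x::'n \<Rightarrow> real. (\<exists>i. x i \<noteq> 0) \<longrightarrow> (\<Sum>i\<in>UNIV. \<Sum>j\<in>UNIV. x i * d i * A i j * x j) > 0))"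

definition indecomposable :: "('n \<Rightarrow> 'n \<Rightarrow> int) \<Rightarrow> bool" where
  "indecomposable A \<longleftrightarrow> (\<forall>J. J \<noteq> {} \<and> J \<noteq> UNIV \<longrightarrow> (\<exists>i\<in>J. \<exists>j. j \<notin> J \<and> A i j \<noteq> 0))"

text \<open>Kac convention: A i j = <alpha_i^vee, alpha_j>.  So alpha_j has fundamental-weight
 coordinates (A i j)_i, and <mu, alpha_j> = sum_i mu_i A i j for mu in Q^vee.\<close>

definition alpha :: "('n::{finite,linorder} \<Rightarrow> 'n \<Rightarrow> int) \<Rightarrow> 'n \<Rightarrow> 'n lat" where
  "alpha A j = (\<Sum>i\<in>UNIV. Poly_Mapping.single i (A i j))"

definition amult :: "'n aff \<Rightarrow> 'n aff \<Rightarrow> 'n aff" where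
  "amult x y = (case x of (a, b, \<mu>) \<Rightarrow> case y of (a', b', \<nu>) \<Rightarrow> (a \<circ> a', b \<circ> b', \<mu> + b \<nu>))"

definition aone :: "'n aff" where
  "aone = (id, id, 0)"

definition sgen :: "('n::{finite,linorder} \<Rightarrow> 'n \<Rightarrow> int) \<Rightarrow> 'n \<Rightarrow> 'n aff" where
  "sgen A i = ((\<lambda>la. la - lsc (Poly_Mapping.lookup la i) (alpha A i)),
               (\<lambda>\<mu>. \<mu> - lsc (lpair \<mu> (alpha A i)) (unitv i)), 0)"

inductive_set weylW :: "('n::{finite,linorder} \<Rightarrow> 'n \<Rightarrow> int) \<Rightarrow> 'n aff set" for A where
  one: "aone \<in> weylW A"
| step: "w \<in> weylW A \<Longrightarrow> amult w (sgen A i) \<in> weylW A"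

definition roots :: "('n::{finite,linorder} \<Rightarrow> 'n \<Rightarrow> int) \<Rightarrow> 'n lat set" where
  "roots A = {fst w (alpha A i) | w i. w \<in> weylW A}"

definition highest_root :: "('n::{finite,linorder} \<Rightarrow> 'n \<Rightarrow> int) \<Rightarrow> 'n lat" where
  "highest_root A = (THE \<theta>. \<theta> \<in> roots A \<and>
      (\<forall>\<beta>\<in>roots A. \<exists>c::'n \<Rightarrow> nat. \<theta> - \<beta> = (\<Sum>i\<in>UNIV. lsc (int (c i)) (alpha A i))))"

definition coroot :: "('n::{finite,linorder} \<Rightarrow> 'n \<Rightarrow> int) \<Rightarrow> 'n lat \<Rightarrow> 'n lat" where
  "coroot A \<beta> = (SOME c. \<exists>w\<in>weylW A. \<exists>i. fst w (alpha A i) = \<beta> \<and> fst (snd w) (unitv i) = c)"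

text \<open>s_0 = t_{theta^vee} s_theta; at level zero it acts on P as s_theta.\<close>
definition szero :: "('n::{finite,linorder} \<Rightarrow> 'n \<Rightarrow> int) \<Rightarrow> 'n aff" where
  "szero A = (let \<theta> = highest_root A; \<theta>v = coroot A \<theta> in
      ((\<lambda>la. la - lsc (lpair \<theta>v la) \<theta>), (\<lambda>\<mu>. \<mu> - lsc (lpair \<mu> \<theta>) \<theta>v), \<theta>v))"

definition agen :: "('n::{finite,linorder} \<Rightarrow> 'n \<Rightarrow> int) \<Rightarrow> 'n option \<Rightarrow> 'n aff" where
  "agen A j = (case j of None \<Rightarrow> szero A | Some i \<Rightarrow> sgen A i)"

text \<open>Level-zero simple roots: alpha_0 acts as -theta.\<close>
definition aalpha :: "('n::{finite,linorder} \<Rightarrow> 'n \<Rightarrow> int) \<Rightarrow> 'n option \<Rightarrow> 'n lat" where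
  "aalpha A j = (case j of None \<Rightarrow> - highest_root A | Some i \<Rightarrow> alpha A i)"

inductive_set affW :: "('n::{finite,linorder} \<Rightarrow> 'n \<Rightarrow> int) \<Rightarrow> 'n aff set" for A where
  one: "aone \<in> affW A"
| step: "w \<in> affW A \<Longrightarrow> amult w (agen A j) \<in> affW A"

definition wordprod :: "('n::{finite,linorder} \<Rightarrow> 'n \<Rightarrow> int) \<Rightarrow> 'n option list \<Rightarrow> 'n aff" where
  "wordprod A ws = foldr (\<lambda>j x. amult (agen A j) x) ws aone"

definition len :: "('n::{finite,linorder} \<Rightarrow> 'n \<Rightarrow> int) \<Rightarrow> 'n aff \<Rightarrow> nat" where
  "len A x = (LEAST k. \<exists>ws. length ws = k \<and> wordprod A ws = x)"

definition redword :: "('n::{finite,linorder} \<Rightarrow> 'n \<Rightarrow> int) \<Rightarrow> 'n aff \<Rightarrow> 'n option list" where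
  "redword A x = (SOME ws. wordprod A ws = x \<and> length ws = len A x)"

definition demazure :: "('n::{finite,linorder} \<Rightarrow> 'n \<Rightarrow> int) \<Rightarrow> 'n aff \<Rightarrow> 'n aff \<Rightarrow> 'n aff" where
  "demazure A x y = foldr (\<lambda>j v. if len A v < len A (amult (agen A j) v) then amult (agen A j) v else v)
                          (redword A x) y"

definition affW0 :: "('n::{finite,linorder} \<Rightarrow> 'n \<Rightarrow> int) \<Rightarrow> 'n aff set" where
  "affW0 A = {x \<in> affW A. \<forall>w\<in>weylW A. len A x \<le> len A (amult x w)}"

definition actR :: "'n::{finite,linorder} aff \<Rightarrow> 'n rep \<Rightarrow> 'n rep" where
  "actR x f = (\<Sum>la\<in>Poly_Mapping.keys f. Poly_Mapping.single (fst x la) (Poly_Mapping.lookup f la))"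

text \<open>Functions affW -> Frac(R(T)); (a . psi)(b) = <b a, psi>.\<close>

definition eact :: "'n::{finite,linorder} rep \<Rightarrow> ('n aff \<Rightarrow> 'n frac) \<Rightarrow> ('n aff \<Rightarrow> 'n frac)" where
  "eact f \<psi> = (\<lambda>b. fr (actR b f) * \<psi> b)"

definition sact :: "('n::{finite,linorder} \<Rightarrow> 'n \<Rightarrow> int) \<Rightarrow> 'n option \<Rightarrow> ('n aff \<Rightarrow> 'n frac) \<Rightarrow> ('n aff \<Rightarrow> 'n frac)" where
  "sact A j \<psi> = (\<lambda>b. \<psi> (amult b (agen A j)))"

definition Tact :: "('n::{finite,linorder} \<Rightarrow> 'n \<Rightarrow> int) \<Rightarrow> 'n option \<Rightarrow> ('n aff \<Rightarrow> 'n frac) \<Rightarrow> ('n aff \<Rightarrow> 'n frac)" where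
  "Tact A j \<psi> = (\<lambda>b. (\<psi> (amult b (agen A j)) - \<psi> b) / fr (1 - echar (fst b (aalpha A j))))"

definition yact :: "('n::{finite,linorder} \<Rightarrow> 'n \<Rightarrow> int) \<Rightarrow> 'n option \<Rightarrow> ('n aff \<Rightarrow> 'n frac) \<Rightarrow> ('n aff \<Rightarrow> 'n frac)" where
  "yact A j \<psi> = (\<lambda>b. \<psi> b + Tact A j \<psi> b)"

definition pairT :: "('n::{finite,linorder} \<Rightarrow> 'n \<Rightarrow> int) \<Rightarrow> 'n aff \<Rightarrow> ('n aff \<Rightarrow> 'n frac) \<Rightarrow> 'n frac" where
  "pairT A v \<psi> = foldr (Tact A) (redword A v) \<psi> aone"

definition schub :: "('n::{finite,linorder} \<Rightarrow> 'n \<Rightarrow> int) \<Rightarrow> 'n aff \<Rightarrow> ('n aff \<Rightarrow> 'n frac)" where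
  "schub A w = (THE \<psi>. (\<forall>b. b \<notin> affW A \<longrightarrow> \<psi> b = 0) \<and>
                        (\<forall>v\<in>affW A. pairT A v \<psi> = (if v = w then 1 else 0)))"

definition lineb :: "'n::{finite,linorder} lat \<Rightarrow> ('n aff \<Rightarrow> 'n frac)" where   (* [L_lambda](t_mu v) = e^{v lambda} *)
  "lineb la = (\<lambda>b. fr (echar (fst b la)))"

text \<open>theta and eta on localizations: (theta psi)(t_mu v) = psi(t_mu), (eta psi)(t_mu v) = psi(v).\<close>
definition thetaOp :: "('n::{finite,linorder} aff \<Rightarrow> 'n frac) \<Rightarrow> ('n aff \<Rightarrow> 'n frac)" where
  "thetaOp \<psi> = (\<lambda>b. \<psi> (id, id, snd (snd b)))"

definition etaOp :: "('n::{finite,linorder} aff \<Rightarrow> 'n frac) \<Rightarrow> ('n aff \<Rightarrow> 'n frac)" where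
  "etaOp \<psi> = (\<lambda>b. \<psi> (fst b, fst (snd b), 0))"

end

theory Submission
  imports "HOL-Analysis.Analysis" Defs
begin

text \<open>
  For a reduced word of \<open>v\<close> the operator \<open>T\<^sub>v\<close> involves only the values at elements of length at most
  \<open>\<ell>(v)\<close>, with nonzero coefficient at \<open>v\<close>. By this triangularity the dual family \<open>\<psi>\<^sup>w\<close> exists, is
  unique, and every function satisfies \<open>f(v) = \<Sum> \<langle>T\<^sub>y, f\<rangle> \<psi>\<^sup>y(v)\<close>. Since \<open>T\<^sub>v\<close> does not depend on the
  reduced word and \<open>T\<^sub>j\<close> squares to \<open>- T\<^sub>j\<close>, one has \<open>T\<^sub>x T\<^sub>y = \<plusminus> T\<^bsub>x*y\<^esub>\<close>, and \<open>T\<^sub>j \<psi>\<^sup>u\<close> is either zero or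
  \<open>\<psi>\<^bsup>u s\<^sub>j\<^esup> - \<psi>\<^sup>u\<close>; this gives (2) and the first half of (3). Expanding \<open>\<psi>\<^sup>w(t v)\<close> twice, first in \<open>v\<close>
  and then in the translation \<open>t\<close>, which acts trivially on coefficients, gives the sum in (3).

  Independence of the reduced word is Matsumoto's theorem together with the braid relations. The
  latter follow from expanding \<open>f(b s\<^sub>i s\<^sub>j \<dots>) = f(b s\<^sub>j s\<^sub>i \<dots>)\<close> in the \<open>T\<close>-words at \<open>b\<close>: the coefficients of
  all shorter words agree by a polynomial (Yang-Baxter) identity, hence so do the two longest words.
  The Coxeter combinatorics is obtained from the action on root coordinates, where an element has
  \<open>j\<close> as a descent iff it makes the \<open>j\<close>-th simple root negative.
\<close>

section \<open>Word combinatorics of Weyl groups\<close>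

text \<open>The word combinatorics is developed once, for an integer matrix, and used twice. With
  the finite matrix it yields the sign dichotomy of roots and hence the highest root, which has to
  be understood before anything can be said about \<open>szero\<close>; with the affine matrix
  \<open>Chat\<close> it yields lengths. The obstacle in between is that the level-zero action on P
  forgets translations, so that lengths cannot be read off from it. The action on affine root
  coordinates is faithful, and \<open>len\<close> is transported to it. The sign in (3) counts the
  letters absorbed in \<open>demazure A x1 x2\<close>, each costing a factor -1 from the square
  relation. Since u is minimal in its coset and not the identity, its only right descent is
  \<open>s_0\<close>; so \<open>u s_0\<close> is shorter than u by one, and this is the source of
  the -1 next to the length of u in the exponent.\<close>

definition coroot_eval :: "('j::finite \<Rightarrow> 'j \<Rightarrow> int) \<Rightarrow> 'j \<Rightarrow> ('j \<Rightarrow> int) \<Rightarrow> int" where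
  "coroot_eval C i f = (\<Sum>k\<in>UNIV. C i k * f k)"

text \<open>The simple reflection in coordinates with respect to the simple roots: subtracting a
  multiple of alpha_i changes the coordinate at i only. Integer functions in place of a vector space
  let the finite and the affine matrix share everything that follows.\<close>

definition wrefl :: "('j::finite \<Rightarrow> 'j \<Rightarrow> int) \<Rightarrow> 'j \<Rightarrow> ('j \<Rightarrow> int) \<Rightarrow> ('j \<Rightarrow> int)" where
  "wrefl C i f = f(i := f i - coroot_eval C i f)"

abbreviation ev :: "('j::finite \<Rightarrow> 'j \<Rightarrow> int) \<Rightarrow> 'j list \<Rightarrow> ('j \<Rightarrow> int) \<Rightarrow> ('j \<Rightarrow> int)" where
  "ev C ws \<equiv> foldr (wrefl C) ws"

definition uvec :: "'j \<Rightarrow> 'j \<Rightarrow> int" where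
  "uvec i = (\<lambda>k. if k = i then 1 else 0)"

fun alt :: "'j \<Rightarrow> 'j \<Rightarrow> nat \<Rightarrow> 'j list" where
  "alt i j 0 = []"
| "alt i j (Suc k) = i # alt j i k"

lemma length_alt [simp]: "length (alt i j k) = k"
  by (induction k arbitrary: i j) auto

lemma alt_Suc_snoc: "alt i j (Suc k) = alt i j k @ [if even k then i else j]"
proof (induction k arbitrary: i j)
  case (Suc k)
  have "alt i j (Suc (Suc k)) = i # alt j i (Suc k)" by simp
  also have "\<dots> = i # alt j i k @ [if even k then j else i]" unfolding Suc ..
  finally show ?case by simp
qed simp

lemma rev_alt: "rev (alt i j k) = (if even k then alt j i k else alt i j k)"
proof (induction k arbitrary: i j)
  case (Suc k)
  have "rev (alt i j (Suc k)) = (if even k then i else j) # rev (alt i j k)"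
    by (simp only: alt_Suc_snoc) simp
  then show ?case unfolding Suc by (simp del: alt.simps add: alt.simps(2))
qed simp

lemma coroot_eval_lin: "coroot_eval C i (\<lambda>x. p * f x + q * g x) = p * coroot_eval C i f + q * coroot_eval C i g"
  by (simp add: coroot_eval_def sum.distrib sum_distrib_left algebra_simps)

lemma wrefl_lin: "wrefl C i (\<lambda>x. p * f x + q * g x) = (\<lambda>x. p * wrefl C i f x + q * wrefl C i g x)"
  by (auto simp: wrefl_def coroot_eval_lin algebra_simps)

lemma ev_lin: "ev C ws (\<lambda>x. p * f x + q * g x) = (\<lambda>x. p * ev C ws f x + q * ev C ws g x)"
  by (induction ws) (simp_all add: wrefl_lin)

lemma ev_uminus: "ev C ws (\<lambda>x. - f x) = (\<lambda>x. - ev C ws f x)"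
  using ev_lin[of C ws "-1" f 0 f] by simp

lemma ev_zero: "ev C ws (\<lambda>x. 0) = (\<lambda>x. 0)"
  using ev_lin[of C ws 0 undefined 0 undefined] by simp

lemma sum_fun_upd:
  "(\<Sum>k\<in>UNIV. c k * (f(i := v)) k) = (\<Sum>k\<in>UNIV. c k * f k) + c i * (v - f i :: int)"
  for c :: "'j::finite \<Rightarrow> int"
proof -
  have "(\<Sum>k\<in>UNIV. c k * (f(i := v)) k) - (\<Sum>k\<in>UNIV. c k * f k)
      = (\<Sum>k\<in>UNIV. if k = i then c i * (v - f i) else 0)"
    unfolding sum_subtractf[symmetric] by (intro sum.cong) (auto simp: algebra_simps)
  then show ?thesis by simp
qed

lemma coroot_eval_upd: "coroot_eval C i (f(j := v)) = coroot_eval C i f + C i j * (v - f j)"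
  unfolding coroot_eval_def by (rule sum_fun_upd)

lemma coroot_eval_uvec [simp]: "coroot_eval C i (uvec j) = C i j"
  by (simp add: coroot_eval_def uvec_def if_distrib[of "\<lambda>x. _ * x"] cong: if_cong)

text \<open>The admissible pairs are the rank-two types A1 x A1, A2, B2 and G2, together with
  (-2,-2), the type of affine A1. The last is the only pair of infinite order in an untwisted affine
  diagram; \<open>Chat_mixed\<close> later rules out (-1,-4) and (-4,-1).\<close>

locale weyl_words =
  fixes C :: "'j::finite \<Rightarrow> 'j \<Rightarrow> int"
  assumes diag [simp]: "C i i = 2"
    and offdiag: "i \<noteq> j \<Longrightarrow> (C i j, C j i) \<in> {(0,0), (-1,-1), (-1,-2), (-2,-1), (-1,-3), (-3,-1), (-2,-2)}"
begin

text \<open>The order of \<open>s\<^sub>i s\<^sub>j\<close>, with 0 standing for infinite order.\<close>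

definition braid_order :: "'j \<Rightarrow> 'j \<Rightarrow> nat" where
  "braid_order i j = (let p = C i j * C j i in if p = 0 then 2 else if p = 1 then 3 else if p = 2 then 4 else if p = 3 then 6 else 0)"

lemma braid_order_sym: "braid_order i j = braid_order j i"
  by (simp add: braid_order_def mult.commute)

text \<open>The length of the transformation, not of the word, defined from the action alone. It is
  identified with \<open>len\<close> in \<open>len_wordprod\<close>, once the affine action is known
  to be faithful.\<close>

definition word_len :: "'j list \<Rightarrow> nat" where
  "word_len ws = (LEAST n. \<exists>us. length us = n \<and> ev C us = ev C ws)"

lemma wrefl_wrefl [simp]: "wrefl C i (wrefl C i f) = f"
  by (simp add: wrefl_def coroot_eval_upd)

lemma ev_rev_cancel [simp]: "ev C (rev ws) (ev C ws f) = f" "ev C ws (ev C (rev ws) f) = f"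
proof -
  show A: "ev C (rev ws) (ev C ws f) = f" for ws f
    by (induction ws arbitrary: f) auto
  show "ev C ws (ev C (rev ws) f) = f" using A[of "rev ws" f] by simp
qed

lemma ev_eq_cancel_right: "ev C (xs @ zs) = ev C (ys @ zs) \<longleftrightarrow> ev C xs = ev C ys"
proof
  assume a: "ev C (xs @ zs) = ev C (ys @ zs)"
  show "ev C xs = ev C ys"
  proof
    fix f show "ev C xs f = ev C ys f"
      using fun_cong[OF a, of "ev C (rev zs) f"] by simp
  qed
qed (simp add: fun_eq_iff)

lemma ev_append_cong: "ev C xs = ev C ys \<Longrightarrow> ev C (xs @ zs) = ev C (ys @ zs)"
  by (simp add: fun_eq_iff)

lemma word_len_le: "ev C us = ev C ws \<Longrightarrow> word_len ws \<le> length us"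
  unfolding word_len_def by (rule Least_le) auto

lemma word_len_ex: "\<exists>us. ev C us = ev C ws \<and> length us = word_len ws"
  unfolding word_len_def by (rule LeastI2_ex) auto

lemma word_len_cong: "ev C us = ev C ws \<Longrightarrow> word_len us = word_len ws"
  unfolding word_len_def by simp

lemma word_len_append_le: "word_len (ws @ vs) \<le> word_len ws + length vs"
proof -
  obtain us where "ev C us = ev C ws" "length us = word_len ws" using word_len_ex by blast
  then show ?thesis using word_len_le[of "us @ vs" "ws @ vs", OF ev_append_cong] by simp
qed

lemma word_len_append_ge: "word_len ws \<le> word_len (ws @ vs) + length vs"
proof -
  have "word_len ws = word_len ((ws @ vs) @ rev vs)" by (intro word_len_cong) (simp add: fun_eq_iff)
  then show ?thesis using word_len_append_le[of "ws @ vs" "rev vs"] by simp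
qed

lemma word_len_cancel: "word_len (ws @ [j, j]) = word_len ws"
  by (intro word_len_cong) (simp add: fun_eq_iff)

section \<open>Rank-two subsystems and the braid relations of the reflections\<close>

definition comb :: "'j \<Rightarrow> 'j \<Rightarrow> int \<Rightarrow> int \<Rightarrow> 'j \<Rightarrow> int" where
  "comb i j p q = (\<lambda>x. p * uvec i x + q * uvec j x)"

lemma wrefl_comb:
  assumes "i \<noteq> j"
  shows "wrefl C i (comb i j p q) = comb i j (- p - C i j * q) q"
    "wrefl C j (comb i j p q) = comb i j p (- q - C j i * p)"
  using assms unfolding comb_def wrefl_def coroot_eval_lin coroot_eval_uvec by (auto simp: uvec_def fun_eq_iff)

text \<open>The images of alpha_j under s_i, s_j s_i, s_i s_j s_i and so on. Below the braid order
  they are positive roots of the rank-two system, and on this both the ascent criterion and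
  \<open>two_descents\<close> rest.\<close>

definition alt_root :: "'j \<Rightarrow> 'j \<Rightarrow> nat \<Rightarrow> 'j \<Rightarrow> int" where
  "alt_root i j k = ev C (rev (alt i j k)) (uvec j)"

lemma alt_root_0: "alt_root i j 0 = comb i j 0 1"
  by (simp add: alt_root_def comb_def)

lemma alt_root_Suc: "alt_root i j (Suc k) = wrefl C (if even k then i else j) (alt_root i j k)"
  unfolding alt_root_def alt_Suc_snoc by simp

lemma nonneg_combI:
  "p \<ge> 0 \<Longrightarrow> q \<ge> 0 \<Longrightarrow> \<exists>p'\<ge>0. \<exists>q'\<ge>0. comb i j p q = comb i j p' q'"
  by blast

lemma alt_root_nonneg:
  assumes "i \<noteq> j" and "braid_order i j = 0 \<or> k < braid_order i j"
  shows "\<exists>p q. p \<ge> 0 \<and> q \<ge> 0 \<and> alt_root i j k = comb i j p q"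
proof (cases "braid_order i j = 0")
  case True
  then have c: "C i j = -2" "C j i = -2" using offdiag[OF assms(1)] by (auto simp: braid_order_def)
  \<comment> \<open>With delta the sum of the two simple roots, these are k delta + alpha_j for even
    k and k delta + alpha_i for odd k.\<close>
  have "alt_root i j k = (if even k then comb i j (int k) (int k + 1) else comb i j (int k + 1) (int k))"
    by (induction k) (auto simp: alt_root_0 alt_root_Suc wrefl_comb[OF assms(1)] c algebra_simps)
  then show ?thesis
    by (cases "even k") (use nonneg_combI[of "int k" "int k + 1"] nonneg_combI[of "int k + 1" "int k"] in auto)
next
  case False
  then have "k < braid_order i j" using assms(2) by auto
  moreover have "braid_order i j \<le> 6" by (simp add: braid_order_def Let_def)
  ultimately have "k \<in> {0,1,2,3,4,5}" by auto
  then show ?thesis using \<open>k < braid_order i j\<close> offdiag[OF assms(1)]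
    by (auto simp: braid_order_def eval_nat_numeral alt_root_0 alt_root_Suc wrefl_comb[OF assms(1)])
       (rule nonneg_combI; simp)+
qed

text \<open>Keeping the decrements P and Q of the two affected coordinates apart leaves f opaque;
  the braid relation becomes a linear identity in the pairings of f with the two coroots.\<close>

definition shift :: "('j \<Rightarrow> int) \<Rightarrow> 'j \<Rightarrow> 'j \<Rightarrow> int \<Rightarrow> int \<Rightarrow> 'j \<Rightarrow> int" where
  "shift f i j P Q = f(i := f i - P, j := f j - Q)"

lemma wrefl_shift:
  assumes "i \<noteq> j"
  shows "wrefl C i (shift f i j P Q) = shift f i j (coroot_eval C i f - P - C i j * Q) Q"
    "wrefl C j (shift f i j P Q) = shift f i j P (coroot_eval C j f - Q - C j i * P)"
  using assms by (auto simp: shift_def wrefl_def coroot_eval_upd fun_eq_iff)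

text \<open>For infinite order \<open>braid_order\<close> is 0 and both words are empty; each finite
  type is a direct computation with \<open>wrefl_shift\<close>.\<close>

lemma ev_braid:
  assumes "i \<noteq> j"
  shows "ev C (alt i j (braid_order i j)) = ev C (alt j i (braid_order i j))"
proof
  fix f
  have f: "f = shift f i j 0 0" by (simp add: shift_def)
  show "ev C (alt i j (braid_order i j)) f = ev C (alt j i (braid_order i j)) f"
    using offdiag[OF assms]
    by (subst (1 2) f) (auto simp: braid_order_def eval_nat_numeral wrefl_shift[OF assms] add.commute)
qed

section \<open>Descents and the sign of root coordinates\<close>

definition nonneg :: "('j \<Rightarrow> int) \<Rightarrow> bool" where
  "nonneg f \<longleftrightarrow> (\<forall>k. f k \<ge> 0)"

lemma ev_comb: "ev C ws (comb i j p q) = (\<lambda>x. p * ev C ws (uvec i) x + q * ev C ws (uvec j) x)"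
  unfolding comb_def by (rule ev_lin)

lemma ev_snoc_uvec: "ev C (ws @ [j]) (uvec j) = (\<lambda>x. - ev C ws (uvec j) x)"
proof -
  have "wrefl C j (uvec j) = (\<lambda>x. - uvec j x)" unfolding wrefl_def coroot_eval_uvec by (auto simp: uvec_def fun_eq_iff)
  then show ?thesis by (simp add: ev_uminus)
qed

text \<open>A letter lowers the length by at most one, so a total drop of k over k letters forces a
  drop of exactly one at each of them.\<close>

lemma word_len_alt_between:
  assumes "word_len (ws @ alt i j k) + k = word_len ws" "k' \<le> k"
  shows "word_len (ws @ alt i j k') + k' = word_len ws"
proof -
  have "\<exists>vs. alt i j k = alt i j k' @ vs \<and> length vs = k - k'"
    using assms(2)
  proof (induction k rule: dec_induct)
    case (step n)
    then show ?case unfolding alt_Suc_snoc by (auto simp: Suc_diff_le)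
  qed simp
  then obtain vs where vs: "alt i j k = alt i j k' @ vs" "length vs = k - k'" by blast
  have "word_len (ws @ alt i j k') \<le> word_len (ws @ alt i j k) + (k - k')"
    using word_len_append_ge[of "ws @ alt i j k'" vs] vs by simp
  moreover have "word_len ws \<le> word_len (ws @ alt i j k') + k'"
    using word_len_append_ge[of ws "alt i j k'"] by simp
  ultimately show ?thesis using assms by linarith
qed

lemma last_letter:
  assumes "word_len ws \<noteq> 0"
  obtains i where "Suc (word_len (ws @ [i])) = word_len ws"
proof -
  obtain us where us: "ev C us = ev C ws" "length us = word_len ws" using word_len_ex by blast
  then obtain us' i where us': "us = us' @ [i]" using assms by (cases us rule: rev_cases) auto
  have "ev C (ws @ [i]) = ev C ((us' @ [i]) @ [i])"
    using us(1) us' by (intro ev_append_cong) simp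
  also have "\<dots> = ev C us'" by (simp add: fun_eq_iff)
  finally have "word_len (ws @ [i]) \<le> length us'" using word_len_le[of us' "ws @ [i]"] by simp
  moreover have "word_len ws \<le> word_len (ws @ [i]) + 1" using word_len_append_ge[of ws "[i]"] by simp
  ultimately show ?thesis using us(2) us' that[of i] by simp
qed

lemma word_len_alt_step:
  assumes "word_len (ws @ alt i j k @ [if even k then i else j]) < word_len (ws @ alt i j k)"
    and "word_len (ws @ alt i j k) + k = word_len ws"
  shows "word_len (ws @ alt i j (Suc k)) + Suc k = word_len ws"
  using assms word_len_append_ge[of "ws @ alt i j k" "[if even k then i else j]"]
  unfolding alt_Suc_snoc by (simp split: if_splits)

text \<open>Strip from the element the longest alternating suffix in its last letter \<open>i\<close> and \<open>j\<close>. What remains has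
  neither as a descent, and the suffix is shorter than the braid length, so it maps the \<open>j\<close>-th simple root
  to a nonnegative combination of the two simple roots.\<close>

theorem ascent_nonneg:
  assumes "word_len ws \<le> word_len (ws @ [j])"
  shows "nonneg (ev C ws (uvec j))"
  using assms
proof (induction "word_len ws" arbitrary: ws j rule: less_induct)
  case (less ws j)
  show ?case
  proof (cases "word_len ws = 0")
    case True
    then have "ev C ws = ev C []" using word_len_ex[of ws] by auto
    then show ?thesis by (simp add: nonneg_def uvec_def)
  next
    case False
    then obtain i where i: "Suc (word_len (ws @ [i])) = word_len ws" by (rule last_letter)
    with less.prems have ij: "i \<noteq> j" by auto
    define K where "K = {k. word_len (ws @ alt i j k) + k = word_len ws}"
    have fin: "finite K" unfolding K_def by (rule finite_subset[of _ "{..word_len ws}"]) auto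
    have K1: "1 \<in> K" using i by (simp add: K_def)
    define k where "k = Max K"
    have kK: "k \<in> K" unfolding k_def using K1 by (intro Max_in[OF fin]) auto
    have k1: "k \<ge> 1" unfolding k_def using K1 by (rule Max_ge[OF fin])
    have kmax: "Suc k \<notin> K"
    proof
      assume "Suc k \<in> K"
      then have "Suc k \<le> k" unfolding k_def by (rule Max_ge[OF fin])
      then show False by simp
    qed
    define v where "v = ws @ alt i j k"
    have lv: "word_len v + k = word_len ws" using kK by (simp add: K_def v_def)
    define n where "n = (if even k then i else j)"
    define n' where "n' = (if even k then j else i)"
    have "word_len v \<le> word_len (v @ [n])"
    proof (rule ccontr)
      assume "\<not> ?thesis"
      then have "word_len (ws @ alt i j k @ [if even k then i else j]) < word_len (ws @ alt i j k)"
        by (simp add: v_def n_def)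
      then have "Suc k \<in> K" using lv unfolding K_def v_def mem_Collect_eq by (rule word_len_alt_step)
      then show False using kmax by simp
    qed
    moreover have "word_len v \<le> word_len (v @ [n'])"
    proof -
      obtain k0 where k0: "k = Suc k0" using k1 by (cases k) auto
      have "word_len (v @ [n']) = word_len (ws @ alt i j k0)"
        unfolding v_def k0 alt_Suc_snoc n'_def by (rule word_len_cong) (simp add: fun_eq_iff)
      moreover have "word_len (ws @ alt i j k0) + k0 = word_len ws"
        using word_len_alt_between[of ws i j k k0] kK k0 by (simp add: K_def)
      ultimately show ?thesis using lv k0 by simp
    qed
    moreover have "word_len v < word_len ws" using lv k1 by simp
    ultimately have pn: "nonneg (ev C v (uvec n))" "nonneg (ev C v (uvec n'))"
      using less.hyps by blast+
    then have pij: "nonneg (ev C v (uvec i))" "nonneg (ev C v (uvec j))"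
      by (auto simp: n_def n'_def split: if_splits)
    \<comment> \<open>A suffix of full braid length could be rewritten by the braid relation so as
      to end in j, and j would be a descent of ws.\<close>
    have "braid_order i j = 0 \<or> k < braid_order i j"
    proof (rule ccontr)
      assume "\<not> ?thesis"
      then obtain m' where m: "braid_order i j = Suc m'" and mk: "Suc m' \<le> k" by (cases "braid_order i j") auto
      define v' where "v' = ws @ alt i j (Suc m')"
      have lv': "word_len v' + Suc m' = word_len ws"
        using word_len_alt_between[of ws i j k "Suc m'"] kK mk by (simp add: K_def v'_def)
      have br: "ev C (alt i j (Suc m')) = ev C (alt j i (Suc m'))" using ev_braid[OF ij] m by simp
      have "ev C (ws @ [j]) = ev C (v' @ rev (alt i j m'))"
      proof
        fix f
        have "ev C (v' @ rev (alt i j m')) f = ev C ws (ev C (alt j i (Suc m')) (ev C (rev (alt i j m')) f))"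
          unfolding v'_def br[symmetric] by (simp del: alt.simps)
        also have "\<dots> = ev C (ws @ [j]) f" by simp
        finally show "ev C (ws @ [j]) f = ev C (v' @ rev (alt i j m')) f" ..
      qed
      then have "word_len (ws @ [j]) = word_len (v' @ rev (alt i j m'))" by (rule word_len_cong)
      also have "\<dots> \<le> word_len v' + m'" using word_len_append_le[of v' "rev (alt i j m')"] by simp
      finally show False using less.prems lv' by simp
    qed
    then obtain p q where pq: "p \<ge> 0" "q \<ge> 0" "alt_root i j k = comb i j p q"
      using alt_root_nonneg[OF ij] by blast
    have "ev C ws (uvec j) = ev C v (alt_root i j k)"
      unfolding v_def alt_root_def by simp
    then show ?thesis using pij pq by (simp add: ev_comb nonneg_def)
  qed
qed

text \<open>The ascent criterion applies to the product with s_j, and s_j sends alpha_j to its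
  negative.\<close>

lemma descent_nonpos:
  assumes "word_len (ws @ [j]) < word_len ws"
  shows "ev C ws (uvec j) k \<le> 0"
proof -
  have "word_len (ws @ [j]) \<le> word_len ((ws @ [j]) @ [j])" using assms by (simp add: word_len_cancel)
  then have "nonneg (ev C (ws @ [j]) (uvec j))" by (rule ascent_nonneg)
  then show ?thesis unfolding ev_snoc_uvec nonneg_def by simp
qed

lemma ev_uvec_nonzero: "\<exists>k. ev C ws (uvec j) k \<noteq> 0"
proof (rule ccontr)
  assume "\<not> ?thesis"
  then have "ev C ws (uvec j) = (\<lambda>k. 0)" by auto
  then have "ev C (rev ws) (ev C ws (uvec j)) j = 0" by (simp add: ev_zero)
  then show False by (simp add: uvec_def)
qed

lemma not_both_signs:
  assumes "nonneg (ev C ws (uvec j))" and "\<And>k. ev C ws (uvec j) k \<le> 0"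
  shows False
  using assms ev_uvec_nonzero[of ws j] unfolding nonneg_def by (meson order_antisym)

text \<open>If the two lengths were equal, j would be an ascent of both elements and the image of
  alpha_j would have both signs. This takes the place of the usual parity argument by
  determinants.\<close>

lemma word_len_snoc_cases: "word_len (ws @ [j]) = Suc (word_len ws) \<or> Suc (word_len (ws @ [j])) = word_len ws"
proof -
  have "word_len (ws @ [j]) \<noteq> word_len ws"
  proof
    assume a: "word_len (ws @ [j]) = word_len ws"
    then have "nonneg (ev C ws (uvec j))" by (intro ascent_nonneg) simp
    moreover have "nonneg (ev C (ws @ [j]) (uvec j))"
      using a by (intro ascent_nonneg) (simp add: word_len_cancel)
    ultimately show False using not_both_signs[of ws j] unfolding ev_snoc_uvec nonneg_def by auto
  qed
  then show ?thesis using word_len_append_le[of ws "[j]"] word_len_append_ge[of ws "[j]"] by auto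
qed

text \<open>Both simple roots go to nonpositive vectors, hence so does every nonnegative combination
  of them, and each further letter of the alternating word is again a descent. For infinite order k
  is arbitrary, so two such descents cannot coexist.\<close>

lemma two_descents:
  assumes "i \<noteq> j" "word_len (ws @ [i]) < word_len ws" "word_len (ws @ [j]) < word_len ws" "braid_order i j = 0 \<or> k \<le> braid_order i j"
  shows "word_len (ws @ alt i j k) + k = word_len ws"
  using assms(4)
proof (induction k)
  case (Suc k)
  then have IH: "word_len (ws @ alt i j k) + k = word_len ws" by auto
  define n where "n = (if even k then i else j)"
  have "\<exists>p q. p \<ge> 0 \<and> q \<ge> 0 \<and> ev C (alt i j k) (uvec n) = comb i j p q"
  proof (cases "even k")
    case True
    \<comment> \<open>For even k the word \<open>alt i j k\<close> is the reversal of
      \<open>alt j i k\<close>, so this is the root sequence with i and j exchanged.\<close>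
    then have "ev C (alt i j k) (uvec n) = alt_root j i k" by (simp add: n_def alt_root_def rev_alt)
    moreover obtain p q where "p \<ge> 0" "q \<ge> 0" "alt_root j i k = comb j i p q"
      using alt_root_nonneg[of j i k] assms(1) Suc.prems by (auto simp: braid_order_sym)
    moreover have "comb j i p q = comb i j q p" by (simp add: comb_def add.commute)
    ultimately show ?thesis by metis
  next
    case False
    then have "ev C (alt i j k) (uvec n) = alt_root i j k" by (simp add: n_def alt_root_def rev_alt)
    then show ?thesis using alt_root_nonneg[of i j k] assms(1) Suc.prems by auto
  qed
  then obtain p q where pq: "p \<ge> 0" "q \<ge> 0" "ev C (alt i j k) (uvec n) = comb i j p q" by blast
  have np: "ev C (ws @ alt i j k) (uvec n) x \<le> 0" for x
    using descent_nonpos[OF assms(2), of x] descent_nonpos[OF assms(3), of x] pq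
    by (simp add: ev_comb add_nonpos_nonpos mult_nonneg_nonpos)
  have "word_len (ws @ alt i j k @ [n]) < word_len (ws @ alt i j k)"
  proof (rule ccontr)
    assume "\<not> ?thesis"
    then have "nonneg (ev C (ws @ alt i j k) (uvec n))" by (intro ascent_nonneg) simp
    then show False using np by (rule not_both_signs)
  qed
  then show ?case using word_len_alt_step[of ws i j k] IH unfolding n_def by blast
qed simp

lemma uvec_comb: "i \<noteq> j \<Longrightarrow> uvec i = comb i j 1 0" "i \<noteq> j \<Longrightarrow> uvec j = comb i j 0 1"
  by (simp_all add: comb_def)

lemma word_len_rev: "word_len (rev ws) = word_len ws"
proof -
  have "word_len (rev ws) \<le> word_len ws" for ws
  proof -
    obtain us where us: "ev C us = ev C ws" "length us = word_len ws" using word_len_ex by blast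
    have "ev C (rev us) = ev C (rev ws)"
    proof
      fix f
      have "ev C (rev us) f = ev C (rev us) (ev C ws (ev C (rev ws) f))" by simp
      then show "ev C (rev us) f = ev C (rev ws) f" by (simp flip: us(1))
    qed
    then show ?thesis using word_len_le[of "rev us" "rev ws"] us(2) by simp
  qed
  from this[of ws] this[of "rev ws"] show ?thesis by simp
qed

lemma word_len_Cons_cases: "word_len (j # ws) = Suc (word_len ws) \<or> Suc (word_len (j # ws)) = word_len ws"
  using word_len_snoc_cases[of "rev ws" j] word_len_rev[of "j # ws"] word_len_rev[of ws] by simp

section \<open>Reduced words and Matsumoto's theorem\<close>

definition reduced :: "'j list \<Rightarrow> bool" where
  "reduced ws \<longleftrightarrow> word_len ws = length ws"

lemma reduced_butlast: "reduced (ws @ [j]) \<Longrightarrow> reduced ws"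
  unfolding reduced_def using word_len_le[of ws ws] word_len_append_le[of ws "[j]"] by simp

text \<open>Equal last letters cancel. If i and j are distinct last letters, both are descents and
  the element ends in the longest word of the rank-two subgroup; the two given words are compared
  with a common prefix followed by that longest word, written once with last letter i and once with
  last letter j. The operators X are arbitrary apart from the braid relations, so the non-invertible
  \<open>T_j\<close> qualify.\<close>

theorem matsumoto:
  fixes X :: "'j \<Rightarrow> 'x \<Rightarrow> 'x"
  assumes braid: "\<And>i j. i \<noteq> j \<Longrightarrow> foldr X (alt i j (braid_order i j)) = foldr X (alt j i (braid_order i j))"
    and "reduced ws" "reduced ws'" "ev C ws = ev C ws'"
  shows "foldr X ws = foldr X ws'"
  using assms(2-4)
proof (induction "length ws" arbitrary: ws ws')
  case 0
  then have "length ws' = 0" using word_len_cong[OF 0(4)] by (simp add: reduced_def)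
  then show ?case using 0 by simp
next
  case (Suc n)
  have same_last: "foldr X (xs @ [k]) = foldr X (ys @ [k])"
    if "length (xs @ [k]) = Suc n" "reduced (xs @ [k])" "reduced (ys @ [k])" "ev C (xs @ [k]) = ev C (ys @ [k])"
    for xs ys k
  proof -
    have "ev C xs = ev C ys" using that(4) by (simp only: ev_eq_cancel_right)
    then have "foldr X xs = foldr X ys"
      using Suc.hyps(1)[of xs ys] that reduced_butlast by (metis diff_Suc_1 length_append_singleton)
    then show ?thesis by (simp add: fun_eq_iff)
  qed
  have len': "length ws' = Suc n"
    using Suc.prems Suc.hyps(2) word_len_cong[of ws ws'] by (simp add: reduced_def)
  obtain xs i where xs: "ws = xs @ [i]" using Suc.hyps(2) by (cases ws rule: rev_cases) auto
  obtain ys j where ys: "ws' = ys @ [j]" using len' by (cases ws' rule: rev_cases) auto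
  show ?case
  proof (cases "i = j")
    case True
    then show ?thesis using same_last[of xs i ys] Suc.prems Suc.hyps(2) xs ys by simp
  next
    case False
    have d: "word_len (us @ [k]) < word_len us" if "us = zs @ [k]" "reduced us" for us zs k
    proof -
      have "word_len (us @ [k]) = word_len zs" unfolding that by (simp add: word_len_cancel)
      then show ?thesis using that word_len_le[of zs zs] by (simp add: reduced_def)
    qed
    have di: "word_len (ws @ [i]) < word_len ws" using d xs Suc.prems by blast
    have "word_len (ws' @ [j]) < word_len ws'" using d ys Suc.prems by blast
    then have dj: "word_len (ws @ [j]) < word_len ws"
      using word_len_cong[of ws ws'] word_len_cong[of "ws @ [j]" "ws' @ [j]"] ev_append_cong[of ws ws'] Suc.prems by metis
    define m where "m = braid_order i j"
    \<comment> \<open>Infinite order would allow one more letter to be stripped than the length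
      permits.\<close>
    have m0: "m \<noteq> 0"
    proof
      assume "m = 0"
      then have "word_len (ws @ alt i j (Suc (word_len ws))) + Suc (word_len ws) = word_len ws"
        using two_descents[OF False di dj, of "Suc (word_len ws)"] unfolding m_def by blast
      then show False by linarith
    qed
    then obtain m' where m': "m = Suc m'" by (cases m) auto
    have lm: "word_len (ws @ alt i j m) + m = word_len ws"
      using two_descents[OF False di dj] by (simp add: m_def)
    obtain zs where zs: "ev C zs = ev C (ws @ alt i j m)" "length zs = word_len (ws @ alt i j m)"
      using word_len_ex by blast
    have br: "ev C (alt i j m) = ev C (alt j i m)" using ev_braid[OF False] by (simp add: m_def)
    have 1: "ev C (zs @ rev (alt i j m)) = ev C ws"
    proof -
      have "ev C (zs @ rev (alt i j m)) = ev C ((ws @ alt i j m) @ rev (alt i j m))"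
        by (rule ev_append_cong) (rule zs)
      then show ?thesis by (simp add: fun_eq_iff)
    qed
    have 2: "ev C (zs @ rev (alt j i m)) = ev C ws"
    proof -
      have "ev C (zs @ rev (alt j i m)) = ev C ((ws @ alt i j m) @ rev (alt j i m))"
        by (rule ev_append_cong) (rule zs)
      then show ?thesis by (simp add: fun_eq_iff br)
    qed
    have r: "reduced (zs @ rev (alt i j m))" "reduced (zs @ rev (alt j i m))"
      using word_len_cong[OF 1] word_len_cong[OF 2] zs lm by (auto simp: reduced_def)
    \<comment> \<open>The reversal of \<open>alt i j m\<close> ends in its first letter i, which
      makes \<open>same_last\<close> applicable.\<close>
    have "foldr X ws = foldr X (zs @ rev (alt i j m))"
      using same_last[of xs i "zs @ rev (alt j i m')"] xs Suc.hyps(2) Suc.prems(1) r(1) 1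
      by (simp add: m')
    also have "\<dots> = foldr X (zs @ rev (alt j i m))"
      using braid[OF False] by (simp add: rev_alt m_def fun_eq_iff)
    also have "\<dots> = foldr X ws'"
      using same_last[of ys j "zs @ rev (alt i j m')"] ys len' Suc.prems r(2) 2 Suc.hyps(2) xs
      by (simp add: m')
    finally show ?thesis .
  qed
qed

end

section \<open>Finite root systems and the affine Weyl group\<close>

lemma lookup_lsc [simp]: "Poly_Mapping.lookup (lsc c v) k = c * Poly_Mapping.lookup v k"
  unfolding lsc_def lookup_sum lookup_single by (simp add: when_def)

lemma lookup_alpha [simp]: "Poly_Mapping.lookup (alpha A j) i = A i j"
  unfolding alpha_def lookup_sum lookup_single by (simp add: when_def)

lemma lookup_unitv [simp]: "Poly_Mapping.lookup (unitv i) k = (if k = i then 1 else 0)"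
  unfolding unitv_def lookup_single by (simp add: when_def)

lemma lat_eqI: "(\<And>k. Poly_Mapping.lookup x k = Poly_Mapping.lookup y k) \<Longrightarrow> x = y"
  by (rule poly_mapping_eqI)

lemma lpair_minus_left: "lpair (x - y) z = lpair x z - lpair y z"
  by (simp add: lpair_def lookup_minus sum_subtractf left_diff_distrib)

lemma lpair_minus_right: "lpair z (x - y) = lpair z x - lpair z y"
  by (simp add: lpair_def lookup_minus sum_subtractf right_diff_distrib)

lemma lpair_plus_left: "lpair (x + y) z = lpair x z + lpair y z"
  by (simp add: lpair_def lookup_add sum.distrib distrib_right)

lemma lpair_uminus_left: "lpair (- x) z = - lpair x z"
  by (simp add: lpair_def sum_negf)

lemma lpair_uminus_right: "lpair z (- x) = - lpair z x"
  by (simp add: lpair_def sum_negf)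

lemma lpair_lsc_left: "lpair (lsc c x) z = c * lpair x z"
  by (simp add: lpair_def sum_distrib_left mult.assoc)

lemma lpair_lsc_right: "lpair z (lsc c x) = c * lpair z x"
  by (simp add: lpair_def sum_distrib_left mult.left_commute)

lemma lpair_unitv_left [simp]: "lpair (unitv i) z = Poly_Mapping.lookup z i"
  by (simp add: lpair_def if_distrib[of "\<lambda>x. x * _"] cong: if_cong)

lemma lpair_unitv_right: "lpair z (unitv i) = Poly_Mapping.lookup z i"
  by (simp add: lpair_def if_distrib[of "\<lambda>x. _ * x"] cong: if_cong)

lemma lpair_zero_left [simp]: "lpair 0 z = 0"
  by (simp add: lpair_def)

lemma lpair_plus_right: "lpair z (x + y) = lpair z x + lpair z y"
  by (simp add: lpair_def lookup_add sum.distrib distrib_left)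

lemmas lpair_simps = lpair_plus_right lpair_minus_left lpair_minus_right lpair_plus_left lpair_uminus_left
  lpair_uminus_right lpair_lsc_left lpair_lsc_right

section \<open>Affine elements as products of generators\<close>

lemma wordprod_Nil [simp]: "wordprod A [] = aone"
  by (simp add: wordprod_def)

lemma wordprod_Cons [simp]: "wordprod A (j # ws) = amult (agen A j) (wordprod A ws)"
  by (simp add: wordprod_def)

lemma fst_amult [simp]: "fst (amult x y) = fst x \<circ> fst y"
  by (simp add: amult_def split: prod.split)

lemma fst_snd_amult [simp]: "fst (snd (amult x y)) = fst (snd x) \<circ> fst (snd y)"
  by (simp add: amult_def split: prod.split)

lemma snd_snd_amult [simp]: "snd (snd (amult x y)) = snd (snd x) + fst (snd x) (snd (snd y))"
  by (simp add: amult_def split: prod.split)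

lemma aone_sel [simp]: "fst aone = id" "fst (snd aone) = id" "snd (snd aone) = 0"
  by (simp_all add: aone_def)

text \<open>The level-zero part of the affine coroot alpha_0^vee is the negative of theta^vee. With
  it all generators act by one and the same reflection formula on P and on Q^vee; only
  \<open>s_0\<close> has a translation part.\<close>

definition acoroot :: "('n::{finite,linorder} \<Rightarrow> 'n \<Rightarrow> int) \<Rightarrow> 'n option \<Rightarrow> 'n lat" where
  "acoroot A j = (case j of None \<Rightarrow> - coroot A (highest_root A) | Some i \<Rightarrow> unitv i)"

lemma fst_agen: "fst (agen A j) l = l - lsc (lpair (acoroot A j) l) (aalpha A j)"
  by (rule lat_eqI)
     (auto simp: agen_def sgen_def szero_def acoroot_def aalpha_def Let_def lookup_minus lpair_simps split: option.split)

lemma fst_snd_agen: "fst (snd (agen A j)) m = m - lsc (lpair m (aalpha A j)) (acoroot A j)"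
  by (rule lat_eqI)
     (auto simp: agen_def sgen_def szero_def acoroot_def aalpha_def Let_def lookup_minus lpair_simps split: option.split)

lemma snd_snd_agen: "snd (snd (agen A j)) = (if j = None then - acoroot A None else 0)"
  by (auto simp: agen_def sgen_def szero_def acoroot_def Let_def split: option.split)

text \<open>The components of an \<open>'n aff\<close> are arbitrary functions, so associativity and
  the right unit law of \<open>amult\<close> depend on additivity of the coroot component. This
  predicate carries that information along words.\<close>

definition lattice_linear :: "('n::{finite,linorder} lat \<Rightarrow> 'n lat) \<Rightarrow> bool" where
  "lattice_linear f \<longleftrightarrow> (\<forall>p c q. f (p + lsc c q) = f p + lsc c (f q))"

lemma lattice_linear_id: "lattice_linear id" by (simp add: lattice_linear_def)

lemma lattice_linear_comp: "lattice_linear f \<Longrightarrow> lattice_linear g \<Longrightarrow> lattice_linear (f \<circ> g)" by (simp add: lattice_linear_def)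

lemma lattice_linear_add: "lattice_linear f \<Longrightarrow> f (p + q) = f p + f q"
proof -
  assume "lattice_linear f"
  moreover have "lsc 1 x = x" for x :: "'a lat" by (rule lat_eqI) simp
  ultimately show ?thesis unfolding lattice_linear_def by metis
qed

lemma lattice_linear_minus: "lattice_linear f \<Longrightarrow> f (p - lsc c q) = f p - lsc c (f q)"
proof -
  assume "lattice_linear f"
  moreover have "p - lsc c q = p + lsc (- c) q" for p q :: "'a lat" by (rule lat_eqI) (simp add: lookup_minus lookup_add)
  ultimately show ?thesis unfolding lattice_linear_def by metis
qed

lemma lattice_linear_0: "lattice_linear f \<Longrightarrow> f 0 = 0"
  using lattice_linear_add[of f 0 0] by simp

lemma lattice_linear_agen: "lattice_linear (fst (agen A j))" "lattice_linear (fst (snd (agen A j)))"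
  unfolding lattice_linear_def fst_agen fst_snd_agen
  by (auto intro!: lat_eqI simp: lpair_simps lookup_add lookup_minus algebra_simps)

lemma amult_assoc: "lattice_linear (fst (snd x)) \<Longrightarrow> amult (amult x y) z = amult x (amult y z)"
  by (intro prod_eqI) (simp_all add: o_assoc lattice_linear_add add.assoc)

lemma lattice_linear_wordprod: "lattice_linear (fst (wordprod A ws))" "lattice_linear (fst (snd (wordprod A ws)))"
  by (induction ws) (simp_all add: lattice_linear_id lattice_linear_comp lattice_linear_agen)

lemma amult_aone [simp]: "amult aone x = x" "lattice_linear (fst (snd x)) \<Longrightarrow> amult x aone = x"
  by (auto intro!: prod_eqI simp: lattice_linear_0)

lemma wordprod_append: "wordprod A (us @ vs) = amult (wordprod A us) (wordprod A vs)"
  by (induction us) (simp_all add: amult_assoc lattice_linear_agen)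

lemma wordprod_single: "wordprod A [j] = agen A j"
  by (simp add: lattice_linear_agen)

lemma affW_iff: "x \<in> affW A \<longleftrightarrow> (\<exists>ws. x = wordprod A ws)"
proof
  show "x \<in> affW A \<Longrightarrow> \<exists>ws. x = wordprod A ws"
  proof (induction rule: affW.induct)
    case one
    show ?case by (rule exI[of _ "[]"]) simp
  next
    case (step w j)
    then show ?case by (metis wordprod_append wordprod_single)
  qed
  have "wordprod A ws \<in> affW A" for ws
  proof (induction ws rule: rev_induct)
    case (snoc j ws)
    then show ?case using affW.step[of "wordprod A ws" A j] by (simp add: wordprod_append lattice_linear_agen)
  qed (simp add: affW.one)
  then show "\<exists>ws. x = wordprod A ws \<Longrightarrow> x \<in> affW A" by blast
qed

lemma weylW_iff: "x \<in> weylW A \<longleftrightarrow> (\<exists>ws. x = wordprod A (map Some ws))"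
proof
  have s: "sgen A i = wordprod A (map Some [i])" for i
    using wordprod_single[of A "Some i"] by (simp add: agen_def)
  show "x \<in> weylW A \<Longrightarrow> \<exists>ws. x = wordprod A (map Some ws)"
  proof (induction rule: weylW.induct)
    case one
    show ?case by (rule exI[of _ "[]"]) simp
  next
    case (step w j)
    then show ?case by (metis wordprod_append s map_append)
  qed
  have "wordprod A (map Some ws) \<in> weylW A" for ws
  proof (induction ws rule: rev_induct)
    case (snoc j ws)
    then show ?case using weylW.step[of "wordprod A (map Some ws)" A j] by (simp add: wordprod_append s del: wordprod_Cons)
  qed (simp add: weylW.one)
  then show "\<exists>ws. x = wordprod A (map Some ws) \<Longrightarrow> x \<in> weylW A" by blast
qed

section \<open>The invariant form and the finite root system\<close>

locale cartan =
  fixes A :: "'n::{finite,linorder} \<Rightarrow> 'n \<Rightarrow> int" and d :: "'n \<Rightarrow> real"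
  assumes A_diag: "A i i = 2"
    and A_off: "i \<noteq> j \<Longrightarrow> A i j \<le> 0"
    and A_zero: "A i j = 0 \<longleftrightarrow> A j i = 0"
    and d_pos: "d i > 0"
    and d_sym: "d i * A i j = d j * A j i"
    and posdef: "x i \<noteq> 0 \<Longrightarrow> (\<Sum>i\<in>UNIV. \<Sum>j\<in>UNIV. x i * d i * A i j * x j) > 0"
    and indec: "J \<noteq> {} \<Longrightarrow> J \<noteq> UNIV \<Longrightarrow> \<exists>i\<in>J. \<exists>j. j \<notin> J \<and> A i j \<noteq> 0"
begin

text \<open>The invariant form on the root lattice, normalised so that alpha_i has square length 2
  d_i.\<close>

definition B :: "('n \<Rightarrow> int) \<Rightarrow> ('n \<Rightarrow> int) \<Rightarrow> real" where
  "B f g = (\<Sum>i\<in>UNIV. real_of_int (f i) * d i * real_of_int (coroot_eval A i g))"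

lemma B_alt: "B f g = (\<Sum>i\<in>UNIV. \<Sum>j\<in>UNIV. real_of_int (f i) * d i * A i j * real_of_int (g j))"
  unfolding B_def coroot_eval_def of_int_sum sum_distrib_left
  by (intro sum.cong refl) (simp add: algebra_simps)

lemma B_sym: "B f g = B g f"
proof -
  have "B f g = (\<Sum>j\<in>UNIV. \<Sum>i\<in>UNIV. real_of_int (f i) * d i * A i j * real_of_int (g j))"
    unfolding B_alt by (rule sum.swap)
  also have "\<dots> = (\<Sum>j\<in>UNIV. \<Sum>i\<in>UNIV. real_of_int (g j) * d j * A j i * real_of_int (f i))"
    by (intro sum.cong refl) (use d_sym in \<open>simp add: algebra_simps\<close>)
  finally show ?thesis unfolding B_alt .
qed

lemma B_lin_left: "B (\<lambda>x. p * f x + q * g x) h = p * B f h + q * B g h"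
  unfolding B_def sum_distrib_left sum.distrib[symmetric] by (intro sum.cong refl) (simp add: algebra_simps)

lemma B_lin_right: "B h (\<lambda>x. p * f x + q * g x) = p * B h f + q * B h g"
  using B_lin_left[of p f q g h] by (simp add: B_sym)

lemma B_uvec_left: "B (uvec i) g = d i * coroot_eval A i g"
  by (simp add: B_def uvec_def if_distrib[of "\<lambda>x. x * _"] if_distrib[of of_int] cong: if_cong)

lemma B_uvec_right: "B g (uvec i) = d i * coroot_eval A i g"
  using B_uvec_left B_sym by simp

lemma B_uvec: "B (uvec i) (uvec i) = 2 * d i"
  by (simp add: B_uvec_left A_diag)

lemma B_pos: "f i \<noteq> 0 \<Longrightarrow> B f f > 0"
  using posdef[of "\<lambda>i. real_of_int (f i)" i] by (simp add: B_alt)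

lemma B_nonneg: "B f f \<ge> 0"
proof (cases "\<exists>i. f i \<noteq> 0")
  case True
  then show ?thesis using B_pos less_imp_le by blast
qed (simp add: B_def)

lemma A_prod_less_4: "i \<noteq> j \<Longrightarrow> A i j * A j i < 4"
proof -
  assume ij: "i \<noteq> j"
  \<comment> \<open>This is -2 times the component of alpha_j orthogonal to alpha_i.\<close>
  define f where "f = (\<lambda>x. A i j * uvec i x + (-2) * uvec j x)"
  have "f j \<noteq> 0" using ij by (simp add: f_def uvec_def)
  then have "0 < B f f" by (rule B_pos)
  also have "B f f = 8 * d j - 2 * d i * (A i j)\<^sup>2"
    unfolding f_def B_lin_left B_lin_right using d_sym[of j i]
    by (simp add: B_uvec B_uvec_left power2_eq_square algebra_simps A_diag)
  also have "2 * d i * (A i j)\<^sup>2 = 2 * d j * (A i j * A j i)"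
    using d_sym[of i j] by (simp add: power2_eq_square algebra_simps)
  finally have "d j * (A i j * A j i) < d j * 4" by simp
  then have "real_of_int (A i j * A j i) < 4" using d_pos[of j] mult_less_cancel_left_pos by blast
  then show ?thesis by linarith
qed

lemma small_products:
  assumes "a \<ge> 0" "b \<ge> 0" "a * b \<le> 3" "a = 0 \<longleftrightarrow> b = (0::int)"
  shows "(a, b) \<in> {(0,0), (1,1), (1,2), (2,1), (1,3), (3,1)}"
proof (cases "a = 0")
  case False
  with assms have ab: "a \<ge> 1" "b \<ge> 1" by auto
  then have "a * 1 \<le> a * b" "1 * b \<le> a * b" by (auto intro: mult_left_mono mult_right_mono)
  then have "a \<le> 3" "b \<le> 3" using assms(3) by linarith+
  with ab have "a = 1 \<or> a = 2 \<or> a = 3" "b = 1 \<or> b = 2 \<or> b = 3" by linarith+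
  then show ?thesis using assms(3) by auto
qed (use assms in auto)

sublocale fin: weyl_words A
proof
  show "A i i = 2" for i by (rule A_diag)
  fix i j :: 'n assume ij: "i \<noteq> j"
  then have "(- A i j, - A j i) \<in> {(0,0), (1,1), (1,2), (2,1), (1,3), (3,1)}"
    using A_off[of i j] A_off[of j i] A_zero[of i j] A_prod_less_4[of i j] by (intro small_products) auto
  then show "(A i j, A j i) \<in> {(0,0), (-1,-1), (-1,-2), (-2,-1), (-1,-3), (-3,-1), (-2,-2)}" by auto
qed

lemma wrefl_alt: "wrefl A i f = (\<lambda>x. 1 * f x + (- coroot_eval A i f) * uvec i x)"
  by (auto simp: wrefl_def uvec_def)

lemma B_wrefl: "B (wrefl A i f) (wrefl A i g) = B f g"
  unfolding wrefl_alt B_lin_left B_lin_right by (simp add: B_uvec B_uvec_left B_uvec_right algebra_simps)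

lemma B_ev: "B (ev A ws f) (ev A ws g) = B f g"
  by (induction ws) (simp_all add: B_wrefl)

lemma B_ev_left: "B (ev A ws f) g = B f (ev A (rev ws) g)"
  using B_ev[of ws f "ev A (rev ws) g"] by simp

text \<open>The Cauchy-Schwarz inequality: n n' is four times the squared cosine of the angle, and h
  = 2 f - n g is twice the component of f orthogonal to g. Equality makes h vanish by
  definiteness.\<close>

lemma integrality_bound:
  assumes "2 * B f g = of_int n * B g g" "2 * B f g = of_int n' * B f f" "f k \<noteq> 0"
  shows "n * n' \<le> 4" and "n * n' = 4 \<Longrightarrow> 2 * f x = n * g x"
proof -
  define h where "h = (\<lambda>x. 2 * f x + (- n) * g x)"
  have "B h h = 4 * B f f - 4 * n * B f g + n * (n * B g g)"
    unfolding h_def B_lin_left B_lin_right using B_sym[of g f] by (simp add: algebra_simps)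
  also have "\<dots> = 4 * B f f - n * (2 * B f g)" using assms(1) by (simp add: algebra_simps)
  also have "\<dots> = B f f * of_int (4 - n * n')" unfolding assms(2) by (simp add: algebra_simps)
  finally have h: "B h h = B f f * of_int (4 - n * n')" .
  have "B f f > 0" using assms(3) by (rule B_pos)
  then have "real_of_int (4 - n * n') \<ge> 0" using h B_nonneg[of h] by (simp add: zero_le_mult_iff)
  then show "n * n' \<le> 4" by linarith
  assume "n * n' = 4"
  then have "B h h = 0" using h by simp
  then have "h x = 0" using B_pos[of h x] by force
  then show "2 * f x = n * g x" by (simp add: h_def)
qed

definition Phi :: "('n \<Rightarrow> int) set" where
  "Phi = {ev A ws (uvec i) | ws i. True}"

lemma Phi_ev: "f \<in> Phi \<Longrightarrow> ev A ws f \<in> Phi"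
  unfolding Phi_def by clarsimp (metis comp_apply foldr_append)

lemma Phi_uvec: "uvec i \<in> Phi"
  unfolding Phi_def using foldr_Nil by (metis (mono_tags, lifting) id_apply mem_Collect_eq)

lemma Phi_wrefl: "f \<in> Phi \<Longrightarrow> wrefl A i f \<in> Phi"
  using Phi_ev[of f "[i]"] by simp

lemma Phi_sign: "f \<in> Phi \<Longrightarrow> (\<forall>k. f k \<ge> 0) \<or> (\<forall>k. f k \<le> 0)"
  unfolding Phi_def using fin.ascent_nonneg fin.descent_nonpos unfolding fin.nonneg_def
  by (auto simp: not_le[symmetric]) (meson not_le)

lemma Phi_nonzero: "f \<in> Phi \<Longrightarrow> \<exists>k. f k \<noteq> 0"
  unfolding Phi_def using fin.ev_uvec_nonzero by auto

lemma ev_sub_uvec: "ev A ws (\<lambda>x. 1 * f x + (- n) * uvec k x) = (\<lambda>x. ev A ws f x - n * ev A ws (uvec k) x)"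
  by (subst ev_lin) simp

text \<open>The reflection in the root b = w alpha_k is w s_k w^(-1). The coefficient is the pairing
  with the coroot of b, and it is an integer because w^(-1) f again has integer coordinates.\<close>

lemma Phi_reflection:
  assumes "b = ev A ws (uvec k)"
  defines "n f \<equiv> coroot_eval A k (ev A (rev ws) f)"
  shows "2 * B b f = of_int (n f) * B b b" and "f \<in> Phi \<Longrightarrow> (\<lambda>x. f x - n f * b x) \<in> Phi"
proof -
  have "B b b = 2 * d k" unfolding assms B_ev by (rule B_uvec)
  moreover have "B b f = d k * n f" unfolding assms B_ev_left B_uvec_left ..
  ultimately show "2 * B b f = of_int (n f) * B b b" by simp
  have "(\<lambda>x. f x - n f * b x) = ev A (ws @ [k] @ rev ws) f"
    by (simp only: foldr_append foldr.simps comp_apply id_apply wrefl_alt ev_sub_uvec n_def assms(1) fin.ev_rev_cancel)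
  then show "f \<in> Phi \<Longrightarrow> (\<lambda>x. f x - n f * b x) \<in> Phi" using Phi_ev by metis
qed

text \<open>Roots have only the square lengths 2 d_i. By compactness of the unit sphere the form is
  bounded below by a positive multiple of the squared norm, so the roots are integer points of a
  bounded box.\<close>

lemma finite_Phi: "finite Phi"
proof -
  define S where "S = (\<lambda>x :: (real, 'n) vec. \<Sum>i\<in>UNIV. \<Sum>j\<in>UNIV. x $ i * d i * A i j * x $ j)"
  have "continuous_on (sphere 0 1) S" unfolding S_def by (intro continuous_intros)
  moreover have "sphere 0 1 \<noteq> ({} :: ((real, 'n) vec) set)" by simp
  ultimately obtain x0 where x0: "x0 \<in> sphere 0 1" "\<And>x. x \<in> sphere 0 1 \<Longrightarrow> S x0 \<le> S x"
    using continuous_attains_inf[of "sphere 0 1" S] compact_sphere by blast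
  have "x0 \<noteq> 0" using x0(1) by auto
  then obtain i0 where "x0 $ i0 \<noteq> 0" by (auto simp: vec_eq_iff)
  then have m: "S x0 > 0" unfolding S_def by (rule posdef)
  have S_scale: "S (c *\<^sub>R x) = c\<^sup>2 * S x" for c x
    unfolding S_def sum_distrib_left by (intro sum.cong refl) (simp add: power2_eq_square algebra_simps)
  have S_ge: "S x0 * (norm x)\<^sup>2 \<le> S x" for x
  proof (cases "x = 0")
    case True then show ?thesis by (simp add: S_def)
  next
    case False
    have "x /\<^sub>R norm x \<in> sphere 0 1" using False by simp
    then have "S x0 \<le> S (x /\<^sub>R norm x)" by (rule x0(2))
    also have "\<dots> = S x / (norm x)\<^sup>2" by (simp add: S_scale power_inverse divide_inverse mult.commute)
    finally show ?thesis using False by (simp add: field_simps)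
  qed
  define M where "M = Max (range (\<lambda>i. 2 * d i))"
  define N where "N = \<lceil>sqrt (M / S x0)\<rceil>"
  have "Phi \<subseteq> {f. \<forall>k. f k \<in> {-N..N}}"
  proof
    fix f assume "f \<in> Phi"
    then obtain ws i where f: "f = ev A ws (uvec i)" by (auto simp: Phi_def)
    have "B f f = 2 * d i" unfolding f B_ev by (rule B_uvec)
    then have "B f f \<le> M" unfolding M_def by simp
    moreover define x :: "(real, 'n) vec" where "x = (\<chi> k. of_int (f k))"
    ultimately have "S x \<le> M" by (simp add: S_def B_alt)
    then have "(norm x)\<^sup>2 \<le> M / S x0" using S_ge[of x] m by (simp add: field_simps)
    then have "norm x \<le> sqrt (M / S x0)" by (rule real_le_rsqrt)
    then have "\<bar>x $ k\<bar> \<le> N" for k using component_le_norm_cart[of x k] unfolding N_def by linarith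
    then have "\<bar>f k\<bar> \<le> N" for k unfolding x_def by (simp flip: of_int_abs)
    then show "f \<in> {f. \<forall>k. f k \<in> {-N..N}}" by (auto simp: abs_le_iff) (metis minus_le_iff)
  qed
  moreover have "finite {f :: 'n \<Rightarrow> int. \<forall>k. f k \<in> {-N..N}}"
    using finite_set_of_finite_funs[of "UNIV :: 'n set" "{-N..N}" 0] by simp
  ultimately show ?thesis by (rule finite_subset)
qed

section \<open>The highest root and its coroot\<close>

lemma finite_arg_max:
  fixes h :: "'x \<Rightarrow> int"
  assumes "finite S" "S \<noteq> {}"
  shows "\<exists>t\<in>S. \<forall>b\<in>S. h b \<le> h t"
proof -
  have "Max (h ` S) \<in> h ` S" using assms by (intro Max_in) auto
  then obtain t where "t \<in> S" "h t = Max (h ` S)" by auto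
  then show ?thesis using assms by (intro bexI[of _ t]) auto
qed

definition height :: "('n \<Rightarrow> int) \<Rightarrow> int" where
  "height f = (\<Sum>k\<in>UNIV. f k)"

lemma height_wrefl: "height (wrefl A i f) = height f - coroot_eval A i f"
  using sum_fun_upd[of "\<lambda>_. 1" f i "f i - coroot_eval A i f"] by (simp add: height_def wrefl_def)

lemma dominant_Phi_pos:
  assumes "f \<in> Phi" "\<And>i. coroot_eval A i f \<ge> 0"
  shows "f k \<ge> 0" and "\<exists>i. coroot_eval A i f > 0"
proof -
  have B: "B f f > 0" using Phi_nonzero[OF assms(1)] B_pos by blast
  show ex: "\<exists>i. coroot_eval A i f > 0"
  proof (rule ccontr)
    assume "\<not> ?thesis"
    then have "\<not> 0 < coroot_eval A i f" for i by blast
    then have "coroot_eval A i f = 0" for i using assms(2)[of i] by (meson not_less order_antisym)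
    then show False using B by (simp add: B_def)
  qed
  have "\<not> (\<forall>k. f k \<le> 0)"
  proof
    assume "\<forall>k. f k \<le> 0"
    then have "B f f \<le> 0" unfolding B_def using d_pos assms(2)
      by (intro sum_nonpos mult_nonpos_nonneg) (auto simp: mult_nonpos_nonneg less_imp_le)
    then show False using B by simp
  qed
  then show "f k \<ge> 0" using Phi_sign[OF assms(1)] by blast
qed

text \<open>A root of maximal height has full support, hence pairs positively with every dominant root; the
  difference of the two is then a root, of the sign dictated by the heights.\<close>

lemma highest_exists: "\<exists>t\<in>Phi. \<forall>b\<in>Phi. \<forall>k. b k \<le> t k"
proof -
  have "\<exists>t\<in>Phi. \<forall>b\<in>Phi. height b \<le> height t"
    using finite_arg_max[OF finite_Phi] Phi_uvec by blast
  then obtain t where t: "t \<in> Phi" "\<And>b. b \<in> Phi \<Longrightarrow> height b \<le> height t" by blast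
  have dom_t: "coroot_eval A i t \<ge> 0" for i
    using t(2)[OF Phi_wrefl[OF t(1), of i]] by (simp add: height_wrefl)
  note t_nonneg = dominant_Phi_pos(1)[OF t(1) dom_t]
  \<comment> \<open>Otherwise the support J is a proper nonempty set and indecomposability gives an
    edge leaving it. At the outer end j of that edge no summand of the pairing is positive and one
    is negative, against dominance.\<close>
  have t_pos: "t k \<ge> 1" for k
  proof (rule ccontr)
    assume k: "\<not> t k \<ge> 1"
    define J where "J = {i. t i \<noteq> 0}"
    have "J \<noteq> {}" using Phi_nonzero[OF t(1)] by (auto simp: J_def)
    moreover have "k \<notin> J" using k t_nonneg[of k] by (auto simp: J_def)
    ultimately obtain i j where ij: "i \<in> J" "j \<notin> J" "A i j \<noteq> 0" using indec[of J] by blast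
    have "coroot_eval A j t = (\<Sum>k\<in>UNIV. A j k * t k)" by (simp add: coroot_eval_def)
    also have "\<dots> \<le> (\<Sum>k\<in>{i}. A j k * t k)"
    proof -
      have "A j k * t k \<le> 0" for k
        using A_off[of j k] t_nonneg[of k] ij(2) by (cases "j = k") (auto simp: J_def mult_nonpos_nonneg)
      then have "(\<Sum>k\<in>UNIV - {i}. A j k * t k) \<le> 0" by (intro sum_nonpos) auto
      then show ?thesis by (subst sum.remove[of UNIV i]) auto
    qed
    also have "\<dots> < 0"
    proof -
      have "A j i < 0" using A_off[of j i] A_zero[of i j] ij by (auto simp: less_le)
      moreover have "t i > 0" using t_nonneg[of i] ij by (auto simp: J_def less_le)
      ultimately show ?thesis by (simp add: mult_neg_pos)
    qed
    finally show False using dom_t[of j] by simp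
  qed
  have "b k \<le> t k" if "b \<in> Phi" for b k
  proof -
    \<comment> \<open>A root c of maximal height above b is dominant: reflecting at a negative
      pairing would raise one coordinate and stay in \<open>Up\<close>.\<close>
    define Up where "Up = {c \<in> Phi. \<forall>k. b k \<le> c k}"
    have fU: "finite Up" and neU: "Up \<noteq> {}" using finite_Phi that by (auto simp: Up_def)
    obtain c where c: "c \<in> Up" "\<And>c'. c' \<in> Up \<Longrightarrow> height c' \<le> height c"
      using finite_arg_max[OF fU neU, of height] by blast
    have cPhi: "c \<in> Phi" and bc: "b k \<le> c k" for k using c(1) by (auto simp: Up_def)
    have dom_c: "coroot_eval A i c \<ge> 0" for i
    proof (rule ccontr)
      assume neg: "\<not> ?thesis"
      have "wrefl A i c \<in> Up"
      proof -
        have "b x \<le> wrefl A i c x" for x using bc[of x] neg by (cases "x = i") (auto simp: wrefl_def)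
        then show ?thesis using Phi_wrefl[OF cPhi] by (simp add: Up_def)
      qed
      then show False using c(2)[of "wrefl A i c"] neg by (simp add: height_wrefl)
    qed
    obtain i where i: "coroot_eval A i c > 0" using dominant_Phi_pos(2)[OF cPhi dom_c] by blast
    have Bpos: "B t c > 0" unfolding B_def
    proof (rule sum_pos2[of _ i])
      show "0 < real_of_int (t i) * d i * real_of_int (coroot_eval A i c)"
        using t_pos[of i] d_pos[of i] i by simp
      show "0 \<le> real_of_int (t i) * d i * real_of_int (coroot_eval A i c)" for i
        using t_pos[of i] d_pos[of i] dom_c[of i] by simp
    qed auto
    have "c k \<le> t k"
    proof (cases "c = t")
      case False
      obtain ws i where t': "t = ev A ws (uvec i)" using t(1) by (auto simp: Phi_def)
      obtain vs j where c': "c = ev A vs (uvec j)" using cPhi by (auto simp: Phi_def)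
      define n where "n = coroot_eval A i (ev A (rev ws) c)"
      define n' where "n' = coroot_eval A j (ev A (rev vs) t)"
      have n: "2 * B c t = of_int n * B t t" "2 * B c t = of_int n' * B c c"
        using Phi_reflection(1)[OF t', of c] Phi_reflection(1)[OF c', of t] by (simp_all add: n_def n'_def B_sym)
      have "B t t > 0" "B c c > 0" using t(1) cPhi Phi_nonzero B_pos by blast+
      then have "n > 0" "n' > 0" using n Bpos B_sym[of t c]
        by (metis of_int_0_less_iff zero_less_mult_pos2 mult_pos_pos zero_less_numeral)+
      obtain k0 where "c k0 \<noteq> 0" using Phi_nonzero cPhi by blast
      note bd = integrality_bound[OF n this]
      \<comment> \<open>Both integers are positive with product at most 4. If both were at least 2,
        the equality case of \<open>integrality_bound\<close> would give c = t.\<close>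
      have "n = 1 \<or> n' = 1"
      proof (rule ccontr)
        assume "\<not> ?thesis"
        then have "n \<ge> 2" "n' \<ge> 2" using \<open>n > 0\<close> \<open>n' > 0\<close> by auto
        then have "2 * 2 \<le> n * n'" "n * 2 \<le> n * n'" by (intro mult_mono; simp)+
        then have "n = 2" "n * n' = 4" using bd(1) \<open>n \<ge> 2\<close> by linarith+
        then have "c x = t x" for x using bd(2)[of x] by simp
        then show False using False by auto
      qed
      then show ?thesis
      proof
        assume "n = 1"
        then have r: "(\<lambda>x. c x - t x) \<in> Phi" using Phi_reflection(2)[OF t' cPhi] by (simp add: n_def)
        have "\<not> (\<forall>k. c k - t k \<ge> 0)"
        proof
          assume a: "\<forall>k. c k - t k \<ge> 0"
          obtain k1 where "c k1 - t k1 \<noteq> 0" using Phi_nonzero[OF r] by auto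
          then have "c k1 - t k1 > 0" using a by (simp add: less_le)
          then have "0 < (\<Sum>k\<in>UNIV. c k - t k)" using a by (intro sum_pos2[of _ k1]) auto
          then show False using t(2)[OF cPhi] by (simp add: sum_subtractf height_def)
        qed
        then show ?thesis using Phi_sign[OF r] by (meson diff_le_0_iff_le)
      next
        assume "n' = 1"
        then have r: "(\<lambda>x. t x - c x) \<in> Phi" using Phi_reflection(2)[OF c' t(1)] by (simp add: n'_def)
        have "\<not> (\<forall>k. t k - c k \<le> 0)"
        proof
          assume a: "\<forall>k. t k - c k \<le> 0"
          obtain k1 where "t k1 - c k1 \<noteq> 0" using Phi_nonzero[OF r] by auto
          then have "c k1 - t k1 > 0" using a by (auto simp: less_le)
          then have "0 < (\<Sum>k\<in>UNIV. c k - t k)" using a by (intro sum_pos2[of _ k1]) auto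
          then show False using t(2)[OF cPhi] by (simp add: sum_subtractf height_def)
        qed
        then show ?thesis using Phi_sign[OF r] by (meson diff_ge_0_iff_ge)
      qed
    qed simp
    then show ?thesis using bc[of k] by simp
  qed
  then show ?thesis using t(1) by blast
qed

lemma nondeg_right:
  assumes "\<And>i. coroot_eval A i f = 0"
  shows "f k = 0"
proof (rule ccontr)
  assume "f k \<noteq> 0"
  then have "B f f > 0" by (rule B_pos)
  then show False using assms by (simp add: B_def)
qed

lemma nondeg_left:
  assumes "\<And>j. lpair m (alpha A j) = 0"
  shows "m = 0"
proof (rule lat_eqI, rule ccontr)
  fix k assume k: "Poly_Mapping.lookup m k \<noteq> Poly_Mapping.lookup 0 k"
  \<comment> \<open>Dividing by d absorbs the symmetriser: the quadratic form at x becomes the sum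
    of the numbers <m, alpha_j> x_j, all of which vanish.\<close>
  define x where "x = (\<lambda>i. real_of_int (Poly_Mapping.lookup m i) / d i)"
  have xd: "x i * d i = real_of_int (Poly_Mapping.lookup m i)" for i
    using d_pos[of i] by (simp add: x_def)
  have "x k \<noteq> 0" using k d_pos[of k] by (simp add: x_def)
  then have "0 < (\<Sum>i\<in>UNIV. \<Sum>j\<in>UNIV. x i * d i * A i j * x j)" by (rule posdef)
  also have "\<dots> = (\<Sum>j\<in>UNIV. \<Sum>i\<in>UNIV. x i * d i * A i j * x j)" by (rule sum.swap)
  also have "\<dots> = (\<Sum>j\<in>UNIV. real_of_int (lpair m (alpha A j)) * x j)"
    unfolding xd by (simp add: lpair_def sum_distrib_right)
  finally show False by (simp add: assms)
qed

definition proot :: "('n \<Rightarrow> int) \<Rightarrow> 'n lat" where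
  "proot f = (\<Sum>k\<in>UNIV. lsc (f k) (alpha A k))"

lemma lookup_proot [simp]: "Poly_Mapping.lookup (proot f) i = coroot_eval A i f"
  unfolding proot_def lookup_sum coroot_eval_def by (simp add: mult.commute)

lemma proot_uvec: "proot (uvec i) = alpha A i"
  by (rule lat_eqI) simp

lemma proot_diff: "proot (\<lambda>x. f x - g x) = proot f - proot g"
  by (rule lat_eqI) (simp add: lookup_minus coroot_eval_def sum_subtractf right_diff_distrib)

lemma proot_inj: "proot f = proot g \<Longrightarrow> f = g"
proof
  fix k assume "proot f = proot g"
  then have "coroot_eval A i (\<lambda>x. f x - g x) = 0" for i
    using proot_diff[of f g] lookup_proot[of "\<lambda>x. f x - g x" i] by simp
  then show "f k = g k" using nondeg_right[of "\<lambda>x. f x - g x" k] by simp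
qed

lemma sgen_proot: "fst (sgen A i) (proot f) = proot (wrefl A i f)"
  by (rule lat_eqI) (simp add: sgen_def lookup_minus wrefl_def coroot_eval_upd)

abbreviation fword :: "'n list \<Rightarrow> 'n aff" where
  "fword ws \<equiv> wordprod A (map Some ws)"

lemma fword_proot: "fst (fword ws) (proot f) = proot (ev A ws f)"
  by (induction ws) (simp_all add: agen_def sgen_proot)

lemma roots_eq: "roots A = proot ` Phi"
proof
  show "roots A \<subseteq> proot ` Phi"
  proof
    fix r assume "r \<in> roots A"
    then obtain w i where w: "w \<in> weylW A" "r = fst w (alpha A i)" by (auto simp: roots_def)
    obtain ws where "w = fword ws" using w(1) weylW_iff by blast
    then have "r = proot (ev A ws (uvec i))" using w(2) fword_proot[of ws "uvec i"] by (simp add: proot_uvec)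
    then show "r \<in> proot ` Phi" unfolding Phi_def by blast
  qed
  show "proot ` Phi \<subseteq> roots A"
  proof
    fix r assume "r \<in> proot ` Phi"
    then obtain ws i where "r = proot (ev A ws (uvec i))" by (auto simp: Phi_def)
    then have "r = fst (fword ws) (alpha A i)" using fword_proot[of ws "uvec i"] by (simp add: proot_uvec)
    moreover have "fword ws \<in> weylW A" using weylW_iff by blast
    ultimately show "r \<in> roots A" unfolding roots_def by blast
  qed
qed

definition highest_vec :: "'n \<Rightarrow> int" where
  "highest_vec = (SOME t. t \<in> Phi \<and> (\<forall>b\<in>Phi. \<forall>k. b k \<le> t k))"

lemma highest_vec: "highest_vec \<in> Phi" "b \<in> Phi \<Longrightarrow> b k \<le> highest_vec k"
proof -
  have "\<exists>t. t \<in> Phi \<and> (\<forall>b\<in>Phi. \<forall>k. b k \<le> t k)" using highest_exists by blast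
  then have "highest_vec \<in> Phi \<and> (\<forall>b\<in>Phi. \<forall>k. b k \<le> highest_vec k)" unfolding highest_vec_def by (rule someI_ex)
  then show "highest_vec \<in> Phi" "b \<in> Phi \<Longrightarrow> b k \<le> highest_vec k" by auto
qed

text \<open>By independence of the simple roots, differences that are nonnegative combinations of
  them correspond to the coordinatewise order, in which a greatest root is unique; this discharges
  the \<open>THE\<close>.\<close>

lemma highest_root_eq: "highest_root A = proot highest_vec"
proof -
  have cone: "(\<exists>c. proot f - proot g = (\<Sum>i\<in>UNIV. lsc (int (c i)) (alpha A i))) \<longleftrightarrow> (\<forall>k. g k \<le> f k)" for f g
  proof
    assume "\<exists>c. proot f - proot g = (\<Sum>i\<in>UNIV. lsc (int (c i)) (alpha A i))"
    then obtain c where "proot (\<lambda>x. f x - g x) = proot (\<lambda>x. int (c x))"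
      unfolding proot_diff by (auto simp: proot_def)
    then have "(\<lambda>x. f x - g x) = (\<lambda>x. int (c x))" by (rule proot_inj)
    then have "f k - g k = int (c k)" for k by (rule fun_cong)
    then show "\<forall>k. g k \<le> f k" by (metis diff_ge_0_iff_ge of_nat_0_le_iff)
  next
    assume "\<forall>k. g k \<le> f k"
    then have "proot (\<lambda>x. f x - g x) = (\<Sum>i\<in>UNIV. lsc (int (nat (f i - g i))) (alpha A i))"
      by (simp add: proot_def)
    then show "\<exists>c. proot f - proot g = (\<Sum>i\<in>UNIV. lsc (int (c i)) (alpha A i))"
      unfolding proot_diff by (intro exI[of _ "\<lambda>i. nat (f i - g i)"])
  qed
  have top: "(\<forall>\<beta>\<in>roots A. \<exists>c::'n \<Rightarrow> nat. proot f - \<beta> = (\<Sum>i\<in>UNIV. lsc (int (c i)) (alpha A i)))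
      \<longleftrightarrow> (\<forall>g\<in>Phi. \<forall>k. g k \<le> f k)" for f
    unfolding roots_eq by (simp add: cone)
  show ?thesis unfolding highest_root_def
  proof (rule the_equality)
    show "proot highest_vec \<in> roots A \<and> (\<forall>\<beta>\<in>roots A. \<exists>c. proot highest_vec - \<beta> = (\<Sum>i\<in>UNIV. lsc (int (c i)) (alpha A i)))"
      unfolding top using highest_vec roots_eq by auto
    fix t assume t: "t \<in> roots A \<and> (\<forall>\<beta>\<in>roots A. \<exists>c. t - \<beta> = (\<Sum>i\<in>UNIV. lsc (int (c i)) (alpha A i)))"
    then obtain f where f: "f \<in> Phi" "t = proot f" unfolding roots_eq by blast
    have "\<forall>g\<in>Phi. \<forall>k. g k \<le> f k" using t unfolding f(2) top by blast
    then have "f k = highest_vec k" for k using highest_vec(1) highest_vec(2)[OF f(1)] by (meson order_antisym)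
    then show "t = proot highest_vec" using f(2) by (simp add: ext[of f highest_vec])
  qed
qed

lemma fword_pairing: "lpair (fst (snd (fword ws)) m) (fst (fword ws) l) = lpair m l"
proof (induction ws)
  case (Cons i ws)
  show ?case
    using Cons by (simp add: agen_def sgen_def lpair_simps lpair_unitv_right A_diag algebra_simps)
qed simp

text \<open>\<open>coroot\<close> chooses its value without fixing w and i. All later facts about
  theta^vee go through some presentation of theta as w alpha_i, which this lemma extracts.\<close>

lemma coroot_word:
  obtains tw tk where "highest_vec = ev A tw (uvec tk)"
    "coroot A (highest_root A) = fst (snd (fword tw)) (unitv tk)"
proof -
  have ex: "\<exists>c. \<exists>w\<in>weylW A. \<exists>i. fst w (alpha A i) = highest_root A \<and> fst (snd w) (unitv i) = c"
  proof -
    have "highest_root A \<in> roots A" using highest_vec(1) roots_eq highest_root_eq by auto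
    then show ?thesis unfolding roots_def by force
  qed
  have "\<exists>w\<in>weylW A. \<exists>i. fst w (alpha A i) = highest_root A \<and> fst (snd w) (unitv i) = coroot A (highest_root A)"
    unfolding coroot_def by (rule someI_ex[OF ex])
  then obtain w i where w: "w \<in> weylW A" "fst w (alpha A i) = highest_root A"
    "fst (snd w) (unitv i) = coroot A (highest_root A)" by blast
  obtain ws where ws: "w = fword ws" using w(1) weylW_iff by blast
  have "proot (ev A ws (uvec i)) = proot highest_vec"
    using w(2) fword_proot[of ws "uvec i"] by (simp add: ws proot_uvec highest_root_eq)
  then show ?thesis using that[of ws i] w(3) ws proot_inj by metis
qed

lemma lpair_coroot:
  assumes "highest_vec = ev A tw (uvec tk)" "coroot A (highest_root A) = fst (snd (fword tw)) (unitv tk)"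
  shows "lpair (coroot A (highest_root A)) (proot f) = coroot_eval A tk (ev A (rev tw) f)"
proof -
  have "proot f = fst (fword tw) (proot (ev A (rev tw) f))" by (simp add: fword_proot)
  then show ?thesis unfolding assms(2) by (simp only: fword_pairing) simp
qed

lemma lpair_coroot_highest: "lpair (coroot A (highest_root A)) (highest_root A) = 2"
proof -
  obtain tw tk where t: "highest_vec = ev A tw (uvec tk)" "coroot A (highest_root A) = fst (snd (fword tw)) (unitv tk)"
    by (rule coroot_word)
  show ?thesis using lpair_coroot[OF t, of highest_vec] by (simp add: highest_root_eq) (simp add: t(1) A_diag)
qed

section \<open>The affine generators and the affine Cartan matrix\<close>

lemma acoroot_aalpha: "lpair (acoroot A j) (aalpha A j) = 2"
  by (cases j) (simp_all add: acoroot_def aalpha_def lpair_simps lpair_coroot_highest A_diag)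

lemma agen_agen: "amult (agen A j) (agen A j) = aone"
proof (intro prod_eqI ext)
  show "fst (amult (agen A j) (agen A j)) l = fst aone l" for l
    by (rule lat_eqI) (simp add: fst_agen lpair_simps acoroot_aalpha lookup_minus)
  show "fst (snd (amult (agen A j) (agen A j))) m = fst (snd aone) m" for m
    by (rule lat_eqI) (simp add: fst_snd_agen lpair_simps acoroot_aalpha lookup_minus)
  show "snd (snd (amult (agen A j) (agen A j))) = snd (snd aone)"
    using acoroot_aalpha[of None]
    by (intro lat_eqI) (simp add: fst_snd_agen snd_snd_agen lpair_simps lookup_minus lookup_add)
qed

lemma wordprod_rev: "amult (wordprod A (rev ws)) (wordprod A ws) = aone"
proof (induction ws)
  case (Cons j ws)
  have "amult (wordprod A (rev (j # ws))) (wordprod A (j # ws))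
     = amult (wordprod A (rev ws)) (amult (amult (agen A j) (agen A j)) (wordprod A ws))"
    by (simp add: wordprod_append amult_assoc lattice_linear_wordprod lattice_linear_agen)
  then show ?case using Cons by (simp add: agen_agen)
qed simp

lemma wordprod_rev': "amult (wordprod A ws) (wordprod A (rev ws)) = aone"
  using wordprod_rev[of "rev ws"] by simp

lemma pairing: "lpair (fst (snd (wordprod A ws)) m) (fst (wordprod A ws) l) = lpair m l"
proof (induction ws)
  case (Cons j ws)
  show ?case using Cons acoroot_aalpha[of j]
    by (simp add: fst_agen fst_snd_agen lpair_simps algebra_simps)
qed simp

text \<open>The affine Cartan matrix. Level-zero representatives suffice to compute it, since the
  imaginary root pairs to zero with every coroot.\<close>

definition Chat :: "'n option \<Rightarrow> 'n option \<Rightarrow> int" where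
  "Chat j k = lpair (acoroot A j) (aalpha A k)"

lemma Chat_Some_Some: "Chat (Some i) (Some k) = A i k"
  and Chat_None_Some: "Chat None (Some i) = - lpair (coroot A (highest_root A)) (alpha A i)"
  and Chat_Some_None: "Chat (Some i) None = - coroot_eval A i highest_vec"
  by (simp_all add: Chat_def acoroot_def aalpha_def lpair_simps highest_root_eq)

text \<open>The two pairings n and n' of theta with alpha_i have product at most 4, and n' is
  nonnegative because no reflection can raise the highest root; n has the same sign. Product 4 makes
  theta proportional to alpha_i. As theta dominates every simple root, the rank is then one, and n =
  n' = 2 is the affine A1 case.\<close>

lemma Chat_mixed: "(Chat None (Some i), Chat (Some i) None) \<in> {(0,0), (-1,-1), (-1,-2), (-2,-1), (-1,-3), (-3,-1), (-2,-2)}"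
proof -
  obtain tw tk where t: "highest_vec = ev A tw (uvec tk)" "coroot A (highest_root A) = fst (snd (fword tw)) (unitv tk)"
    by (rule coroot_word)
  define n where "n = coroot_eval A tk (ev A (rev tw) (uvec i))"
  define n' where "n' = coroot_eval A i highest_vec"
  have C: "Chat None (Some i) = - n" "Chat (Some i) None = - n'"
    using lpair_coroot[OF t, of "uvec i"] by (simp_all add: Chat_None_Some Chat_Some_None n_def n'_def proot_uvec)
  have Bn: "2 * B highest_vec (uvec i) = of_int n * B highest_vec highest_vec"
    using Phi_reflection(1)[OF t(1), of "uvec i"] by (simp add: n_def)
  have Bn': "2 * B highest_vec (uvec i) = of_int n' * B (uvec i) (uvec i)"
    by (simp add: B_uvec_right n'_def A_diag)
  obtain k0 where k0: "highest_vec k0 \<noteq> 0" using Phi_nonzero[OF highest_vec(1)] by blast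
  note bd = integrality_bound[OF Bn' Bn k0]
  have Bt: "B highest_vec highest_vec > 0" using k0 by (rule B_pos)
  have n'0: "n' \<ge> 0"
  proof -
    have "wrefl A i highest_vec i \<le> highest_vec i" by (rule highest_vec(2)[OF Phi_wrefl[OF highest_vec(1)]])
    then show ?thesis by (simp add: wrefl_def n'_def)
  qed
  have eq: "of_int n * B highest_vec highest_vec = of_int n' * (2 * d i)" using Bn Bn' by (simp add: B_uvec_left A_diag)
  have n0: "n \<ge> 0"
  proof -
    have "0 \<le> of_int n * B highest_vec highest_vec" unfolding eq using n'0 d_pos[of i] by simp
    then show ?thesis using Bt by (simp add: zero_le_mult_iff)
  qed
  have z: "n = 0 \<longleftrightarrow> n' = 0" using eq Bt d_pos[of i] by auto
  show ?thesis
  proof (cases "n' * n = 4")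
    case True
    have only: "l = i" for l
    proof (rule ccontr)
      assume "l \<noteq> i"
      then have "highest_vec l = 0" using bd(2)[OF True, of l] by (simp add: uvec_def)
      moreover have "uvec l l \<le> highest_vec l" by (rule highest_vec(2)[OF Phi_uvec])
      ultimately show False by (simp add: uvec_def)
    qed
    have "B highest_vec highest_vec = 2 * d i" unfolding t(1) B_ev B_uvec using only[of tk] by simp
    then have "n = n'" using eq d_pos[of i] by simp
    then have "(n - 2) * (n + 2) = 0" using True by (simp add: algebra_simps)
    then have "n = 2" using n0 by auto
    then show ?thesis using C \<open>n = n'\<close> by simp
  next
    case False
    then have "n * n' \<le> 3" using bd(1) by (simp add: mult.commute)
    then have "(n, n') \<in> {(0,0), (1,1), (1,2), (2,1), (1,3), (3,1)}"
      using n0 n'0 z by (intro small_products)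
    then show ?thesis using C by auto
  qed
qed

sublocale aff: weyl_words Chat
proof
  show "Chat j j = 2" for j by (simp add: Chat_def acoroot_aalpha)
  fix j k :: "'n option" assume jk: "j \<noteq> k"
  show "(Chat j k, Chat k j) \<in> {(0,0), (-1,-1), (-1,-2), (-2,-1), (-1,-3), (-3,-1), (-2,-2)}"
  proof (cases j; cases k)
    fix a b assume "j = Some a" "k = Some b"
    then show ?thesis using fin.offdiag[of a b] jk by (simp add: Chat_Some_Some)
  next
    fix b assume "j = None" "k = Some b"
    then show ?thesis using Chat_mixed[of b] by simp
  next
    fix a assume "j = Some a" "k = None"
    then show ?thesis using Chat_mixed[of a] by auto
  qed (use jk in auto)
qed

text \<open>Root coordinates to the level-zero weight lattice; the kernel is spanned by the imaginary root, and
  the coordinate at \<open>None\<close> records the lost level.\<close>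

definition level_zero :: "('n option \<Rightarrow> int) \<Rightarrow> 'n lat" where
  "level_zero f = (\<Sum>k\<in>UNIV. lsc (f k) (aalpha A k))"

lemma lpair_sum_right: "lpair m (\<Sum>k\<in>S. g k) = (\<Sum>k\<in>S. lpair m (g k))"
  unfolding lpair_def lookup_sum sum_distrib_left by (rule sum.swap)

lemma lpair_level_zero: "lpair (acoroot A j) (level_zero f) = coroot_eval Chat j f"
  by (simp add: level_zero_def lpair_sum_right lpair_lsc_right coroot_eval_def Chat_def mult.commute)

lemma lookup_level_zero: "Poly_Mapping.lookup (level_zero f) i = (\<Sum>k\<in>UNIV. Poly_Mapping.lookup (aalpha A k) i * f k)"
  by (simp add: level_zero_def lookup_sum mult.commute)

lemma agen_level_zero: "fst (agen A j) (level_zero f) = level_zero (wrefl Chat j f)"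
  by (rule lat_eqI) (simp add: fst_agen lpair_level_zero lookup_minus lookup_level_zero wrefl_def sum_fun_upd del: fun_upd_apply)

lemma wordprod_level_zero: "fst (wordprod A ws) (level_zero f) = level_zero (ev Chat ws f)"
  by (induction ws) (simp_all add: agen_level_zero)

text \<open>The translation by mu sends a level-zero weight l to l minus <mu, l> times the imaginary
  root, whose coordinate at \<open>None\<close> is 1.\<close>

lemma wordprod_level: "ev Chat ws f None = f None - lpair (snd (snd (wordprod A ws))) (fst (wordprod A ws) (level_zero f))"
proof (induction ws)
  case (Cons j ws)
  define g where "g = ev Chat ws f"
  have "lpair (fst (snd (agen A j)) m) (fst (agen A j) l) = lpair m l" for m l
    using pairing[of "[j]" m l] by (simp only: wordprod_single)
  moreover have "lpair (snd (snd (agen A j))) (fst (agen A j) (level_zero g)) = (if j = None then coroot_eval Chat None g else 0)"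
    using acoroot_aalpha[of None] by (simp add: snd_snd_agen fst_agen lpair_simps lpair_level_zero)
  moreover have "wrefl Chat j g None = g None - (if j = None then coroot_eval Chat None g else 0)"
    by (simp add: wrefl_def)
  ultimately show ?case using Cons
    by (simp add: wordprod_level_zero lpair_plus_left g_def[symmetric])
qed simp

lemma level_zero_uvec: "level_zero (uvec k) = aalpha A k"
  by (rule lat_eqI) (simp add: lookup_level_zero uvec_def if_distrib[of "\<lambda>x. _ * x"] cong: if_cong)

lemma level_zero_None_inj:
  assumes "level_zero f = level_zero g" "f None = g None"
  shows "f = g"
proof -
  have 1: "level_zero h = proot (\<lambda>i. h (Some i)) + lsc (h None) (aalpha A None)" for h
    by (rule lat_eqI)
      (simp add: lookup_level_zero lookup_add UNIV_option_conv sum.reindex coroot_eval_def mult.commute aalpha_def[of _ "Some _"])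
  have "proot (\<lambda>i. f (Some i)) = proot (\<lambda>i. g (Some i))" using assms unfolding 1 by simp
  then have "(\<lambda>i. f (Some i)) = (\<lambda>i. g (Some i))" by (rule proot_inj)
  then show ?thesis using assms(2) by (metis (no_types) ext option.exhaust)
qed

text \<open>Faithfulness of the action on affine root coordinates: level-zero image and coordinate
  at \<open>None\<close> determine a vector, and conversely the action on the finite simple roots
  determines all three components of an element.\<close>

lemma wordprod_one_iff: "wordprod A us = aone \<longleftrightarrow> ev Chat us = (\<lambda>f. f)"
proof
  assume u: "wordprod A us = aone"
  show "ev Chat us = (\<lambda>f. f)"
  proof
    fix f show "ev Chat us f = f"
      using wordprod_level_zero[of us f] wordprod_level[of us f] u by (intro level_zero_None_inj) simp_all
  qed
next
  assume u: "ev Chat us = (\<lambda>f. f)"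
  have fixes_alpha: "fst (wordprod A us) (alpha A i) = alpha A i" for i
    using wordprod_level_zero[of us "uvec (Some i)"] u by (simp add: level_zero_uvec aalpha_def)
  \<comment> \<open>The simple roots need not span P, so the identity is established on Q^vee by
    nondegeneracy and then carried over to P by the pairing.\<close>
  have bid: "fst (snd (wordprod A us)) m = m" for m
  proof -
    have "lpair (fst (snd (wordprod A us)) m - m) (alpha A i) = 0" for i
      using pairing[of us m "alpha A i"] by (simp add: fixes_alpha lpair_minus_left)
    then show ?thesis using nondeg_left by force
  qed
  have aid: "fst (wordprod A us) l = l" for l
  proof (rule lat_eqI)
    fix k show "Poly_Mapping.lookup (fst (wordprod A us) l) k = Poly_Mapping.lookup l k"
      using pairing[of us "unitv k" l] by (simp add: bid)
  qed
  have "lpair (snd (snd (wordprod A us))) (alpha A i) = 0" for i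
    using wordprod_level[of us "uvec (Some i)"] u by (simp add: level_zero_uvec aalpha_def aid)
  then have "snd (snd (wordprod A us)) = 0" by (rule nondeg_left)
  then show "wordprod A us = aone" using aid bid by (intro prod_eqI ext) simp_all
qed

theorem wordprod_eq_iff: "wordprod A us = wordprod A vs \<longleftrightarrow> ev Chat us = ev Chat vs"
proof -
  have "wordprod A us = wordprod A vs \<longleftrightarrow> wordprod A (rev vs @ us) = aone"
  proof
    assume "wordprod A (rev vs @ us) = aone"
    then have "amult (wordprod A vs) (amult (wordprod A (rev vs)) (wordprod A us)) = wordprod A vs"
      by (simp add: wordprod_append lattice_linear_wordprod)
    then show "wordprod A us = wordprod A vs"
      by (simp add: wordprod_rev' amult_assoc[symmetric] lattice_linear_wordprod)
  qed (simp add: wordprod_append wordprod_rev)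
  also have "\<dots> \<longleftrightarrow> ev Chat (rev vs @ us) = (\<lambda>f. f)" by (rule wordprod_one_iff)
  also have "\<dots> \<longleftrightarrow> ev Chat us = ev Chat vs"
  proof
    assume a: "ev Chat (rev vs @ us) = (\<lambda>f. f)"
    show "ev Chat us = ev Chat vs"
    proof
      fix f show "ev Chat us f = ev Chat vs f"
        using arg_cong[OF fun_cong[OF a, of f], of "ev Chat vs"] by simp
    qed
  qed (intro ext, simp)
  finally show ?thesis .
qed

lemma len_wordprod: "len A (wordprod A ws) = aff.word_len ws"
  by (simp add: len_def aff.word_len_def wordprod_eq_iff)

section \<open>Splitting an affine element into translation and finite part\<close>

lemma snd_snd_fword: "snd (snd (fword ws)) = 0"
  by (induction ws) (simp_all add: agen_def sgen_def lpair_def lat_eqI)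

text \<open>Dropping translations is multiplicative, so only \<open>s_0\<close> needs an argument:
  its finite part s_theta is the conjugate w s_k w^(-1) for a presentation theta = w
  alpha_k.\<close>

lemma finite_part:
  assumes "b \<in> affW A"
  shows "(fst b, fst (snd b), 0) \<in> weylW A"
proof -
  have gen: "\<exists>vs. (fst (agen A j), fst (snd (agen A j)), 0) = fword vs" for j
  proof (cases j)
    case None
    obtain tw tk where t: "highest_vec = ev A tw (uvec tk)" "coroot A (highest_root A) = fst (snd (fword tw)) (unitv tk)"
      by (rule coroot_word)
    have a: "fst (fword tw) (alpha A tk) = highest_root A"
      using fword_proot[of tw "uvec tk"] by (simp add: proot_uvec highest_root_eq t(1))
    have inv: "fst (fword tw) (fst (fword (rev tw)) l) = l"
      "fst (snd (fword tw)) (fst (snd (fword (rev tw))) l) = l" for l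
      using wordprod_rev'[of "map Some tw"]
      by (metis aone_sel comp_apply fst_amult fst_snd_amult id_apply rev_map)+
    have p1: "lpair (unitv tk) (fst (fword (rev tw)) l) = lpair (coroot A (highest_root A)) l" for l
      using fword_pairing[of tw "unitv tk" "fst (fword (rev tw)) l"] by (simp add: inv t(2))
    have p2: "lpair (fst (snd (fword (rev tw))) m) (alpha A tk) = lpair m (highest_root A)" for m
      using fword_pairing[of tw "fst (snd (fword (rev tw))) m" "alpha A tk"] by (simp add: inv a)
    have w: "fword (tw @ [tk] @ rev tw) = amult (fword tw) (amult (agen A (Some tk)) (fword (rev tw)))"
      by (simp add: wordprod_append)
    have "fword (tw @ [tk] @ rev tw) = (fst (agen A j), fst (snd (agen A j)), 0)"
    proof (intro prod_eqI ext)
      show "fst (fword (tw @ [tk] @ rev tw)) l = fst (fst (agen A j), fst (snd (agen A j)), 0) l" for l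
        using p1 a unfolding w None
        by (simp add: agen_def sgen_def szero_def Let_def lattice_linear_minus[OF lattice_linear_wordprod(1)] inv)
      show "fst (snd (fword (tw @ [tk] @ rev tw))) m = fst (snd (fst (agen A j), fst (snd (agen A j)), 0)) m" for m
        using p2 t(2) unfolding w None
        by (simp add: agen_def sgen_def szero_def Let_def lattice_linear_minus[OF lattice_linear_wordprod(2)] inv)
      show "snd (snd (fword (tw @ [tk] @ rev tw))) = snd (snd (fst (agen A j), fst (snd (agen A j)), 0))"
        by (simp only: snd_snd_fword) simp
    qed
    then show ?thesis by metis
  next
    case (Some i)
    have "fword [i] = (fst (agen A j), fst (snd (agen A j)), 0)"
      unfolding Some by (intro prod_eqI) (simp_all add: agen_def sgen_def lpair_def lat_eqI)
    then show ?thesis by metis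
  qed
  obtain ws where "b = wordprod A ws" using assms affW_iff by blast
  moreover have "\<exists>vs. (fst (wordprod A ws), fst (snd (wordprod A ws)), 0) = fword vs"
  proof (induction ws)
    case Nil
    show ?case by (rule exI[of _ "[]"]) (simp add: aone_def id_def)
  next
    case (Cons j ws)
    then obtain vs us where v: "(fst (wordprod A ws), fst (snd (wordprod A ws)), 0) = fword vs"
      "(fst (agen A j), fst (snd (agen A j)), 0) = fword us" using gen[of j] by blast
    have "fword (us @ vs) = (fst (wordprod A (j # ws)), fst (snd (wordprod A (j # ws))), 0)"
      by (simp add: wordprod_append v[symmetric]) (simp add: amult_def fst_snd_agen lat_eqI split: prod.split)
    then show ?case by metis
  qed
  ultimately show ?thesis unfolding weylW_iff by simp
qed

lemma weylW_affW: "w \<in> weylW A \<Longrightarrow> w \<in> affW A"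
  using weylW_iff affW_iff by metis

lemma translation_part:
  assumes "b \<in> affW A"
  shows "(id, id, snd (snd b)) \<in> affW A"
    and "amult (id, id, snd (snd b)) (fst b, fst (snd b), 0) = b"
proof -
  obtain vs where v: "(fst b, fst (snd b), 0) = fword vs" using finite_part[OF assms] weylW_iff by metis
  obtain ws where w: "b = wordprod A ws" using assms affW_iff by blast
  have "amult (fword vs) (fword (rev vs)) = aone" using wordprod_rev'[of "map Some vs"] by (simp add: rev_map)
  then have i: "fst b \<circ> fst (fword (rev vs)) = id" "fst (snd b) \<circ> fst (snd (fword (rev vs))) = id"
    using v by (metis aone_sel fst_amult fst_conv fst_snd_amult snd_conv)+
  have z: "fst (snd b) 0 = 0" unfolding w by (rule lattice_linear_0) (rule lattice_linear_wordprod)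
  have "wordprod A (ws @ map Some (rev vs)) = (id, id, snd (snd b))"
    unfolding wordprod_append w[symmetric] using i z by (intro prod_eqI) (simp_all add: snd_snd_fword)
  then show "(id, id, snd (snd b)) \<in> affW A" using affW_iff by metis
  show "amult (id, id, snd (snd b)) (fst b, fst (snd b), 0) = b"
    by (simp add: amult_def)
qed

end

section \<open>Operators on functions on the affine Weyl group\<close>

text \<open>S and T stand for \<open>T_i\<close> and \<open>T_j\<close>, c0 for b, the chains c and
  d for the elements met while multiplying b by the two braid words, both ending in z, and X, Y for
  the characters of b alpha_i and b alpha_j. The positive roots of the rank-two system supply the
  factors, in one order along c and in the reverse order along d.\<close>

lemma yang_baxter_2:
  fixes S T :: "('x \<Rightarrow> 'f::field) \<Rightarrow> 'x \<Rightarrow> 'f" and X Y :: 'f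
  assumes S: "\<And>f. S (S f) = (\<lambda>x. - S f x)" "\<And>f. S (\<lambda>x. - f x) = (\<lambda>x. - S f x)"
    and T: "\<And>f. T (T f) = (\<lambda>x. - T f x)" "\<And>f. T (\<lambda>x. - f x) = (\<lambda>x. - T f x)"
    and c: "\<And>f. f c1 = f c0 + (1 - X) * S f c0" "\<And>f. f z = f c1 + (1 - Y) * T f c1"
    and d: "\<And>f. f d1 = f c0 + (1 - Y) * T f c0" "\<And>f. f z = f d1 + (1 - X) * S f d1"
    and nz: "X \<noteq> 1" "Y \<noteq> 1"
  shows "S (T f) c0 = T (S f) c0"
proof -
  \<comment> \<open>The zero is kept as \<open>f z - f z\<close> so that one copy can be expanded
    along c and the other along d; all but the two longest words cancel.\<close>
  have "f z - f z = (1 - X) * (1 - Y) * (S (T f) c0 - T (S f) c0)"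
    by (subst (1) c(2), subst d(2)) (simp add: c(1-1) d(1-1) S T, algebra)
  then show ?thesis using nz by simp
qed

lemma yang_baxter_3:
  fixes S T :: "('x \<Rightarrow> 'f::field) \<Rightarrow> 'x \<Rightarrow> 'f" and X Y :: 'f
  assumes S: "\<And>f. S (S f) = (\<lambda>x. - S f x)" "\<And>f. S (\<lambda>x. - f x) = (\<lambda>x. - S f x)"
    and T: "\<And>f. T (T f) = (\<lambda>x. - T f x)" "\<And>f. T (\<lambda>x. - f x) = (\<lambda>x. - T f x)"
    and c: "\<And>f. f c1 = f c0 + (1 - X) * S f c0" "\<And>f. f c2 = f c1 + (1 - X*Y) * T f c1" "\<And>f. f z = f c2 + (1 - Y) * S f c2"
    and d: "\<And>f. f d1 = f c0 + (1 - Y) * T f c0" "\<And>f. f d2 = f d1 + (1 - X*Y) * S f d1" "\<And>f. f z = f d2 + (1 - X) * T f d2"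
    and nz: "X \<noteq> 1" "X*Y \<noteq> 1" "Y \<noteq> 1"
  shows "S (T (S f)) c0 = T (S (T f)) c0"
proof -
  have "f z - f z = (1 - X) * (1 - X*Y) * (1 - Y) * (S (T (S f)) c0 - T (S (T f)) c0)"
    by (subst (1) c(3), subst d(3)) (simp add: c(1-2) d(1-2) S T, algebra)
  then show ?thesis using nz by simp
qed

text \<open>Type B2, with X the character of the long simple root and Y that of the short
  one.\<close>

lemma yang_baxter_4:
  fixes S T :: "('x \<Rightarrow> 'f::field) \<Rightarrow> 'x \<Rightarrow> 'f" and X Y :: 'f
  assumes S: "\<And>f. S (S f) = (\<lambda>x. - S f x)" "\<And>f. S (\<lambda>x. - f x) = (\<lambda>x. - S f x)"
    and T: "\<And>f. T (T f) = (\<lambda>x. - T f x)" "\<And>f. T (\<lambda>x. - f x) = (\<lambda>x. - T f x)"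
    and c: "\<And>f. f c1 = f c0 + (1 - X) * S f c0" "\<And>f. f c2 = f c1 + (1 - X*Y) * T f c1" "\<And>f. f c3 = f c2 + (1 - X*Y^2) * S f c2" "\<And>f. f z = f c3 + (1 - Y) * T f c3"
    and d: "\<And>f. f d1 = f c0 + (1 - Y) * T f c0" "\<And>f. f d2 = f d1 + (1 - X*Y^2) * S f d1" "\<And>f. f d3 = f d2 + (1 - X*Y) * T f d2" "\<And>f. f z = f d3 + (1 - X) * S f d3"
    and nz: "X \<noteq> 1" "X*Y \<noteq> 1" "X*Y^2 \<noteq> 1" "Y \<noteq> 1"
  shows "S (T (S (T f))) c0 = T (S (T (S f))) c0"
proof -
  have "f z - f z = (1 - X) * (1 - X*Y) * (1 - X*Y^2) * (1 - Y) * (S (T (S (T f))) c0 - T (S (T (S f))) c0)"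
    by (subst (1) c(4), subst d(4)) (simp add: c(1-3) d(1-3) S T, algebra)
  then show ?thesis using nz by simp
qed

text \<open>Type G2, again with X long and Y short; the exponents list its six positive
  roots.\<close>

lemma yang_baxter_6:
  fixes S T :: "('x \<Rightarrow> 'f::field) \<Rightarrow> 'x \<Rightarrow> 'f" and X Y :: 'f
  assumes S: "\<And>f. S (S f) = (\<lambda>x. - S f x)" "\<And>f. S (\<lambda>x. - f x) = (\<lambda>x. - S f x)"
    and T: "\<And>f. T (T f) = (\<lambda>x. - T f x)" "\<And>f. T (\<lambda>x. - f x) = (\<lambda>x. - T f x)"
    and c: "\<And>f. f c1 = f c0 + (1 - X) * S f c0" "\<And>f. f c2 = f c1 + (1 - X*Y) * T f c1" "\<And>f. f c3 = f c2 + (1 - X^2*Y^3) * S f c2" "\<And>f. f c4 = f c3 + (1 - X*Y^2) * T f c3" "\<And>f. f c5 = f c4 + (1 - X*Y^3) * S f c4" "\<And>f. f z = f c5 + (1 - Y) * T f c5"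
    and d: "\<And>f. f d1 = f c0 + (1 - Y) * T f c0" "\<And>f. f d2 = f d1 + (1 - X*Y^3) * S f d1" "\<And>f. f d3 = f d2 + (1 - X*Y^2) * T f d2" "\<And>f. f d4 = f d3 + (1 - X^2*Y^3) * S f d3" "\<And>f. f d5 = f d4 + (1 - X*Y) * T f d4" "\<And>f. f z = f d5 + (1 - X) * S f d5"
    and nz: "X \<noteq> 1" "X*Y \<noteq> 1" "X^2*Y^3 \<noteq> 1" "X*Y^2 \<noteq> 1" "X*Y^3 \<noteq> 1" "Y \<noteq> 1"
  shows "S (T (S (T (S (T f))))) c0 = T (S (T (S (T (S f))))) c0"
proof -
  have "f z - f z = (1 - X) * (1 - X*Y) * (1 - X^2*Y^3) * (1 - X*Y^2) * (1 - X*Y^3) * (1 - Y) * (S (T (S (T (S (T f))))) c0 - T (S (T (S (T (S f))))) c0)"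
    by (subst (1) c(6), subst d(6)) (simp add: c(1-5) d(1-5) S T, algebra)
  then show ?thesis using nz by simp
qed

section \<open>Characters in the fraction field\<close>

lemma fr_1 [simp]: "fr 1 = 1" and fr_0 [simp]: "fr 0 = 0"
  by (simp_all add: fr_def One_fract_def Zero_fract_def)

lemma fr_diff: "fr (x - y) = fr x - fr y"
  by (simp add: fr_def)

lemma fr_mult: "fr (x * y) = fr x * fr y"
  by (simp add: fr_def)

lemma fr_eq_iff: "fr x = fr y \<longleftrightarrow> x = y"
  by (simp add: fr_def eq_fract)

lemma fr_power: "fr (x ^ n) = fr x ^ n"
  by (induction n) (simp_all add: fr_mult)

lemma echar_add: "echar (x + y) = echar x * echar y"
  by (simp add: echar_def mult_single)

lemma echar_0 [simp]: "echar 0 = 1"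
  by (simp add: echar_def)

lemma echar_eq_1_iff: "echar x = 1 \<longleftrightarrow> x = 0"
proof
  assume "echar x = 1"
  then have "Poly_Mapping.lookup (echar x) x = Poly_Mapping.lookup (echar 0) x" by simp
  then show "x = 0" unfolding echar_def lookup_single by (auto simp: when_def split: if_splits)
qed simp

lemma echar_lsc: "echar (lsc (int n) x) = echar x ^ n"
proof (induction n)
  case 0
  have "lsc 0 x = 0" by (rule lat_eqI) simp
  then show ?case by simp
next
  case (Suc n)
  have "lsc (int (Suc n)) x = x + lsc (int n) x" by (rule lat_eqI) (simp add: lookup_add algebra_simps)
  then show ?case using Suc by (simp add: echar_add)
qed

text \<open>With c the length of u and d that of \<open>u s_0\<close>, the integer exponent is a + b
  - d - 2, of the same parity as a + b + d.\<close>

lemma powi_sign: "(- 1 :: 'f::field) powi (int a + int b - int c - 1) = (- 1) ^ (a + b + d)" if "Suc d = c"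
  using that[symmetric]
  by (cases "even a"; cases "even b"; cases "even d") (simp_all add: power_int_minus_left minus_one_power_iff)

section \<open>The operators \<open>T_j\<close>: square and braid relations\<close>

context cartan
begin

lemma affW_wordprod [simp]: "wordprod A ws \<in> affW A"
  using affW_iff by blast

lemma affW_lattice_linear: "b \<in> affW A \<Longrightarrow> lattice_linear (fst b)" "b \<in> affW A \<Longrightarrow> lattice_linear (fst (snd b))"
  using affW_iff lattice_linear_wordprod by metis+

lemma affW_mult: "b \<in> affW A \<Longrightarrow> c \<in> affW A \<Longrightarrow> amult b c \<in> affW A"
  using affW_iff wordprod_append by metis

lemma affW_agen [simp]: "agen A j \<in> affW A"
  using affW_wordprod[of "[j]"] by (simp only: wordprod_single)

lemma affW_aone [simp]: "aone \<in> affW A"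
  using affW_wordprod[of "[]"] by simp

lemma affW_append: "b \<in> affW A \<Longrightarrow> amult b (wordprod A ws) \<in> affW A"
  by (simp add: affW_mult)

lemma amult_one_right: "b \<in> affW A \<Longrightarrow> amult b aone = b"
  by (simp add: affW_lattice_linear)

lemma amult_agen_agen: "b \<in> affW A \<Longrightarrow> amult (amult b (agen A j)) (agen A j) = b"
  by (simp add: amult_assoc affW_lattice_linear agen_agen)

lemma agen_agen_amult: "amult (agen A j) (amult (agen A j) b) = b"
  by (simp add: amult_assoc[symmetric] lattice_linear_agen agen_agen)

definition E :: "'n aff \<Rightarrow> 'n option \<Rightarrow> 'n frac" where
  "E b j = fr (echar (fst b (aalpha A j)))"

text \<open>A root pairs to 2 with its coroot, and group elements preserve the pairing, so its image
  is never zero. Hence no denominator of \<open>Tact\<close> vanishes on the group.\<close>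

lemma E_ne_1: "b \<in> affW A \<Longrightarrow> E b j \<noteq> 1"
proof
  assume b: "b \<in> affW A" and "E b j = 1"
  then have "fst b (aalpha A j) = 0"
    using fr_eq_iff[of "echar (fst b (aalpha A j))" 1] by (simp add: E_def echar_eq_1_iff)
  moreover obtain ws where "b = wordprod A ws" using b affW_iff by blast
  ultimately show False using pairing[of ws "acoroot A j" "aalpha A j"] acoroot_aalpha[of j] by (simp add: lpair_def)
qed

lemma E_agen: "b \<in> affW A \<Longrightarrow> E (amult b (agen A j)) j * E b j = 1"
proof -
  assume b: "b \<in> affW A"
  have "fst (agen A j) (aalpha A j) = 0 - lsc 1 (aalpha A j)"
    unfolding fst_agen by (rule lat_eqI) (simp add: acoroot_aalpha lookup_minus)
  then have "fst (amult b (agen A j)) (aalpha A j) = 0 - lsc 1 (fst b (aalpha A j))"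
    using lattice_linear_minus[OF affW_lattice_linear(1)[OF b], of 0 1 "aalpha A j"] lattice_linear_0[OF affW_lattice_linear(1)[OF b]] by simp
  also have "\<dots> + fst b (aalpha A j) = 0" by (rule lat_eqI) (simp add: lookup_add lookup_minus)
  finally have "fst (amult b (agen A j)) (aalpha A j) + fst b (aalpha A j) = 0" .
  then show ?thesis unfolding E_def fr_mult[symmetric] echar_add[symmetric] by simp
qed

lemma level_zero_comb: "level_zero (aff.comb i j p q) = lsc p (aalpha A i) + lsc q (aalpha A j)"
proof (rule lat_eqI)
  fix k
  have "Poly_Mapping.lookup (level_zero (aff.comb i j p q)) k
      = p * Poly_Mapping.lookup (level_zero (uvec i)) k + q * Poly_Mapping.lookup (level_zero (uvec j)) k"
    unfolding lookup_level_zero aff.comb_def sum_distrib_left sum.distrib[symmetric]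
    by (intro sum.cong refl) (simp add: algebra_simps)
  then show "Poly_Mapping.lookup (level_zero (aff.comb i j p q)) k = Poly_Mapping.lookup (lsc p (aalpha A i) + lsc q (aalpha A j)) k"
    by (simp add: level_zero_uvec lookup_add)
qed

text \<open>Natural exponents suffice because the roots met along a braid word are positive.\<close>

lemma E_monomial:
  assumes "b \<in> affW A" "ev Chat us (uvec n) = aff.comb i j (int p) (int q)"
  shows "E (amult b (wordprod A us)) n = E b i ^ p * E b j ^ q"
proof -
  note L = affW_lattice_linear(1)[OF assms(1)]
  have l: "fst b (lsc c x) = lsc c (fst b x)" for c x
    using L lattice_linear_0[OF L] unfolding lattice_linear_def by (metis add_0)
  have "fst (amult b (wordprod A us)) (aalpha A n) = fst b (level_zero (ev Chat us (uvec n)))"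
    using wordprod_level_zero[of us "uvec n"] by (simp add: level_zero_uvec)
  also have "\<dots> = lsc (int p) (fst b (aalpha A i)) + lsc (int q) (fst b (aalpha A j))"
    unfolding assms(2) level_zero_comb by (simp add: lattice_linear_add[OF L] l)
  finally show ?thesis by (simp add: E_def echar_add echar_lsc fr_mult fr_power)
qed

text \<open>Restricted to the affine Weyl group, because elsewhere the denominator of \<open>Tact\<close> may vanish and
  the braid relations may fail.\<close>

definition Tr :: "'n option \<Rightarrow> ('n aff \<Rightarrow> 'n frac) \<Rightarrow> 'n aff \<Rightarrow> 'n frac" where
  "Tr j f b = (if b \<in> affW A then Tact A j f b else 0)"

lemma Tr_eq: "b \<in> affW A \<Longrightarrow> Tr j f b = (f (amult b (agen A j)) - f b) / (1 - E b j)"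
  by (simp add: Tr_def Tact_def E_def fr_diff)

lemma Tr_outside: "b \<notin> affW A \<Longrightarrow> Tr j f b = 0"
  by (simp add: Tr_def)

lemma Tr_step: "b \<in> affW A \<Longrightarrow> f (amult b (agen A j)) = f b + (1 - E b j) * Tr j f b"
  using E_ne_1[of b j] by (simp add: Tr_eq)

lemma step_word:
  assumes "b \<in> affW A" "E (amult b (wordprod A us)) n = e" "us' = us @ [n]"
  shows "f (amult b (wordprod A us')) = f (amult b (wordprod A us)) + (1 - e) * Tr n f (amult b (wordprod A us))"
  using Tr_step[OF affW_append[OF assms(1)], of f us n] assms
  by (simp add: wordprod_append lattice_linear_agen amult_assoc affW_lattice_linear)

lemma Tr_lin: "Tr j (\<lambda>x. p * f x + q * g x) = (\<lambda>x. p * Tr j f x + q * Tr j g x)"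
proof
  fix b show "Tr j (\<lambda>x. p * f x + q * g x) b = p * Tr j f b + q * Tr j g b"
    using E_ne_1[of b j] by (cases "b \<in> affW A") (simp_all add: Tr_eq Tr_outside divide_simps, simp add: algebra_simps)
qed

lemma Tr_uminus: "Tr j (\<lambda>x. - f x) = (\<lambda>x. - Tr j f x)"
  using Tr_lin[of j "-1" f 0 f] by simp

text \<open>The root character at \<open>b s_j\<close> is the inverse of that at b, so
  \<open>T_j f\<close> at \<open>b s_j\<close> equals its value at b multiplied by
  \<open>E b j\<close>.\<close>

lemma Tr_Tr: "Tr j (Tr j f) = (\<lambda>x. - Tr j f x)"
proof
  fix b show "Tr j (Tr j f) b = - Tr j f b"
  proof (cases "b \<in> affW A")
    case True
    define t where "t = Tr j f b"
    have b': "amult b (agen A j) \<in> affW A" using True by (simp add: affW_mult)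
    have f1: "f (amult b (agen A j)) = f b + (1 - E b j) * t" using Tr_step[OF True, of f j] by (simp add: t_def)
    have e0: "E b j \<noteq> 0" using E_agen[OF True, of j] by auto
    have e: "E (amult b (agen A j)) j = 1 / E b j"
      using E_agen[OF True, of j] e0 by (simp add: nonzero_eq_divide_eq)
    have "Tr j f (amult b (agen A j)) = (f b - f (amult b (agen A j))) / (1 - 1 / E b j)"
      using True b' by (simp add: Tr_eq amult_agen_agen e)
    also have "\<dots> = E b j * t"
      unfolding f1 using E_ne_1[OF True, of j] e0 by (simp add: field_simps)
    finally have "Tr j (Tr j f) b = (E b j * t - t) / (1 - E b j)"
      using Tr_eq[OF True, of j "Tr j f"] by (simp add: t_def)
    also have "\<dots> = - t" using E_ne_1[OF True, of j] by (simp add: field_simps)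
    finally show ?thesis by (simp add: t_def)
  qed (simp add: Tr_outside)
qed

text \<open>The exponents passed to \<open>E_monomial\<close> are the coordinates of the roots met
  along each braid word; they turn \<open>step_word\<close> into the hypotheses of the abstract
  identity. That both chains end at the same element is the braid relation in the group. The other
  three types follow the same pattern.\<close>

lemma Tr_braid_2:
  assumes "i \<noteq> j" "b \<in> affW A" "Chat i j = 0" "Chat j i = 0"
  shows "foldr Tr (alt i j 2) f b = foldr Tr (alt j i 2) f b"
proof -
  note e = E_monomial[OF assms(2), where i = i and j = j]
  note ws = aff.uvec_comb[OF assms(1)] aff.wrefl_comb[OF assms(1)] assms(3,4)
  have ce: "E (amult b (wordprod A [])) i = E b i"
    "E (amult b (wordprod A [i])) j = E b j"
    using e[of "[]" i 1 0]
      e[of "[i]" j 0 1]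
    by (simp_all add: ws del: wordprod_Cons)
  have c: "g (amult b (wordprod A [i])) = g (amult b (wordprod A [])) + (1 - E b i) * Tr i g (amult b (wordprod A []))"
    "g (amult b (wordprod A [i, j])) = g (amult b (wordprod A [i])) + (1 - E b j) * Tr j g (amult b (wordprod A [i]))" for g
    by (rule step_word[OF assms(2)], rule ce, simp)+
  have de: "E (amult b (wordprod A [])) j = E b j"
    "E (amult b (wordprod A [j])) i = E b i"
    using e[of "[]" j 0 1]
      e[of "[j]" i 1 0]
    by (simp_all add: ws del: wordprod_Cons)
  have d: "g (amult b (wordprod A [j])) = g (amult b (wordprod A [])) + (1 - E b j) * Tr j g (amult b (wordprod A []))"
    "g (amult b (wordprod A [j, i])) = g (amult b (wordprod A [j])) + (1 - E b i) * Tr i g (amult b (wordprod A [j]))" for g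
    by (rule step_word[OF assms(2)], rule de, simp)+
  note nz = E_ne_1[OF affW_append[OF assms(2), of "[]"], of i, unfolded ce(1)]
    E_ne_1[OF affW_append[OF assms(2), of "[i]"], of j, unfolded ce(2)]
  have z: "amult b (wordprod A [j, i]) = amult b (wordprod A [i, j])"
    using aff.ev_braid[OF assms(1)] assms(3,4)
    by (intro arg_cong[of _ _ "amult b"]) (simp add: wordprod_eq_iff aff.braid_order_def eval_nat_numeral del: wordprod_Cons)
  show ?thesis using yang_baxter_2[OF Tr_Tr Tr_uminus Tr_Tr Tr_uminus c d[unfolded z] nz, of f]
    by (simp add: eval_nat_numeral amult_one_right[OF assms(2)])
qed

lemma Tr_braid_3:
  assumes "i \<noteq> j" "b \<in> affW A" "Chat i j = - 1" "Chat j i = - 1"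
  shows "foldr Tr (alt i j 3) f b = foldr Tr (alt j i 3) f b"
proof -
  note e = E_monomial[OF assms(2), where i = i and j = j]
  note ws = aff.uvec_comb[OF assms(1)] aff.wrefl_comb[OF assms(1)] assms(3,4)
  have ce: "E (amult b (wordprod A [])) i = E b i"
    "E (amult b (wordprod A [i])) j = E b i*E b j"
    "E (amult b (wordprod A [i, j])) i = E b j"
    using e[of "[]" i 1 0]
      e[of "[i]" j 1 1]
      e[of "[i, j]" i 0 1]
    by (simp_all add: ws del: wordprod_Cons)
  have c: "g (amult b (wordprod A [i])) = g (amult b (wordprod A [])) + (1 - E b i) * Tr i g (amult b (wordprod A []))"
    "g (amult b (wordprod A [i, j])) = g (amult b (wordprod A [i])) + (1 - E b i*E b j) * Tr j g (amult b (wordprod A [i]))"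
    "g (amult b (wordprod A [i, j, i])) = g (amult b (wordprod A [i, j])) + (1 - E b j) * Tr i g (amult b (wordprod A [i, j]))" for g
    by (rule step_word[OF assms(2)], rule ce, simp)+
  have de: "E (amult b (wordprod A [])) j = E b j"
    "E (amult b (wordprod A [j])) i = E b i*E b j"
    "E (amult b (wordprod A [j, i])) j = E b i"
    using e[of "[]" j 0 1]
      e[of "[j]" i 1 1]
      e[of "[j, i]" j 1 0]
    by (simp_all add: ws del: wordprod_Cons)
  have d: "g (amult b (wordprod A [j])) = g (amult b (wordprod A [])) + (1 - E b j) * Tr j g (amult b (wordprod A []))"
    "g (amult b (wordprod A [j, i])) = g (amult b (wordprod A [j])) + (1 - E b i*E b j) * Tr i g (amult b (wordprod A [j]))"
    "g (amult b (wordprod A [j, i, j])) = g (amult b (wordprod A [j, i])) + (1 - E b i) * Tr j g (amult b (wordprod A [j, i]))" for g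
    by (rule step_word[OF assms(2)], rule de, simp)+
  note nz = E_ne_1[OF affW_append[OF assms(2), of "[]"], of i, unfolded ce(1)]
    E_ne_1[OF affW_append[OF assms(2), of "[i]"], of j, unfolded ce(2)]
    E_ne_1[OF affW_append[OF assms(2), of "[i, j]"], of i, unfolded ce(3)]
  have z: "amult b (wordprod A [j, i, j]) = amult b (wordprod A [i, j, i])"
    using aff.ev_braid[OF assms(1)] assms(3,4)
    by (intro arg_cong[of _ _ "amult b"]) (simp add: wordprod_eq_iff aff.braid_order_def eval_nat_numeral del: wordprod_Cons)
  show ?thesis using yang_baxter_3[OF Tr_Tr Tr_uminus Tr_Tr Tr_uminus c d[unfolded z] nz, of f]
    by (simp add: eval_nat_numeral amult_one_right[OF assms(2)])
qed

lemma Tr_braid_4: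
  assumes "i \<noteq> j" "b \<in> affW A" "Chat i j = - 1" "Chat j i = - 2"
  shows "foldr Tr (alt i j 4) f b = foldr Tr (alt j i 4) f b"
proof -
  note e = E_monomial[OF assms(2), where i = i and j = j]
  note ws = aff.uvec_comb[OF assms(1)] aff.wrefl_comb[OF assms(1)] assms(3,4)
  have ce: "E (amult b (wordprod A [])) i = E b i"
    "E (amult b (wordprod A [i])) j = E b i*E b j"
    "E (amult b (wordprod A [i, j])) i = E b i*E b j^2"
    "E (amult b (wordprod A [i, j, i])) j = E b j"
    using e[of "[]" i 1 0]
      e[of "[i]" j 1 1]
      e[of "[i, j]" i 1 2]
      e[of "[i, j, i]" j 0 1]
    by (simp_all add: ws del: wordprod_Cons)
  have c: "g (amult b (wordprod A [i])) = g (amult b (wordprod A [])) + (1 - E b i) * Tr i g (amult b (wordprod A []))"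
    "g (amult b (wordprod A [i, j])) = g (amult b (wordprod A [i])) + (1 - E b i*E b j) * Tr j g (amult b (wordprod A [i]))"
    "g (amult b (wordprod A [i, j, i])) = g (amult b (wordprod A [i, j])) + (1 - E b i*E b j^2) * Tr i g (amult b (wordprod A [i, j]))"
    "g (amult b (wordprod A [i, j, i, j])) = g (amult b (wordprod A [i, j, i])) + (1 - E b j) * Tr j g (amult b (wordprod A [i, j, i]))" for g
    by (rule step_word[OF assms(2)], rule ce, simp)+
  have de: "E (amult b (wordprod A [])) j = E b j"
    "E (amult b (wordprod A [j])) i = E b i*E b j^2"
    "E (amult b (wordprod A [j, i])) j = E b i*E b j"
    "E (amult b (wordprod A [j, i, j])) i = E b i"
    using e[of "[]" j 0 1]
      e[of "[j]" i 1 2]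
      e[of "[j, i]" j 1 1]
      e[of "[j, i, j]" i 1 0]
    by (simp_all add: ws del: wordprod_Cons)
  have d: "g (amult b (wordprod A [j])) = g (amult b (wordprod A [])) + (1 - E b j) * Tr j g (amult b (wordprod A []))"
    "g (amult b (wordprod A [j, i])) = g (amult b (wordprod A [j])) + (1 - E b i*E b j^2) * Tr i g (amult b (wordprod A [j]))"
    "g (amult b (wordprod A [j, i, j])) = g (amult b (wordprod A [j, i])) + (1 - E b i*E b j) * Tr j g (amult b (wordprod A [j, i]))"
    "g (amult b (wordprod A [j, i, j, i])) = g (amult b (wordprod A [j, i, j])) + (1 - E b i) * Tr i g (amult b (wordprod A [j, i, j]))" for g
    by (rule step_word[OF assms(2)], rule de, simp)+
  note nz = E_ne_1[OF affW_append[OF assms(2), of "[]"], of i, unfolded ce(1)]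
    E_ne_1[OF affW_append[OF assms(2), of "[i]"], of j, unfolded ce(2)]
    E_ne_1[OF affW_append[OF assms(2), of "[i, j]"], of i, unfolded ce(3)]
    E_ne_1[OF affW_append[OF assms(2), of "[i, j, i]"], of j, unfolded ce(4)]
  have z: "amult b (wordprod A [j, i, j, i]) = amult b (wordprod A [i, j, i, j])"
    using aff.ev_braid[OF assms(1)] assms(3,4)
    by (intro arg_cong[of _ _ "amult b"]) (simp add: wordprod_eq_iff aff.braid_order_def eval_nat_numeral del: wordprod_Cons)
  show ?thesis using yang_baxter_4[OF Tr_Tr Tr_uminus Tr_Tr Tr_uminus c d[unfolded z] nz, of f]
    by (simp add: eval_nat_numeral amult_one_right[OF assms(2)])
qed

lemma Tr_braid_6:
  assumes "i \<noteq> j" "b \<in> affW A" "Chat i j = - 1" "Chat j i = - 3"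
  shows "foldr Tr (alt i j 6) f b = foldr Tr (alt j i 6) f b"
proof -
  note e = E_monomial[OF assms(2), where i = i and j = j]
  note ws = aff.uvec_comb[OF assms(1)] aff.wrefl_comb[OF assms(1)] assms(3,4)
  have ce: "E (amult b (wordprod A [])) i = E b i"
    "E (amult b (wordprod A [i])) j = E b i*E b j"
    "E (amult b (wordprod A [i, j])) i = E b i^2*E b j^3"
    "E (amult b (wordprod A [i, j, i])) j = E b i*E b j^2"
    "E (amult b (wordprod A [i, j, i, j])) i = E b i*E b j^3"
    "E (amult b (wordprod A [i, j, i, j, i])) j = E b j"
    using e[of "[]" i 1 0]
      e[of "[i]" j 1 1]
      e[of "[i, j]" i 2 3]
      e[of "[i, j, i]" j 1 2]
      e[of "[i, j, i, j]" i 1 3]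
      e[of "[i, j, i, j, i]" j 0 1]
    by (simp_all add: ws del: wordprod_Cons)
  have c: "g (amult b (wordprod A [i])) = g (amult b (wordprod A [])) + (1 - E b i) * Tr i g (amult b (wordprod A []))"
    "g (amult b (wordprod A [i, j])) = g (amult b (wordprod A [i])) + (1 - E b i*E b j) * Tr j g (amult b (wordprod A [i]))"
    "g (amult b (wordprod A [i, j, i])) = g (amult b (wordprod A [i, j])) + (1 - E b i^2*E b j^3) * Tr i g (amult b (wordprod A [i, j]))"
    "g (amult b (wordprod A [i, j, i, j])) = g (amult b (wordprod A [i, j, i])) + (1 - E b i*E b j^2) * Tr j g (amult b (wordprod A [i, j, i]))"
    "g (amult b (wordprod A [i, j, i, j, i])) = g (amult b (wordprod A [i, j, i, j])) + (1 - E b i*E b j^3) * Tr i g (amult b (wordprod A [i, j, i, j]))"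
    "g (amult b (wordprod A [i, j, i, j, i, j])) = g (amult b (wordprod A [i, j, i, j, i])) + (1 - E b j) * Tr j g (amult b (wordprod A [i, j, i, j, i]))" for g
    by (rule step_word[OF assms(2)], rule ce, simp)+
  have de: "E (amult b (wordprod A [])) j = E b j"
    "E (amult b (wordprod A [j])) i = E b i*E b j^3"
    "E (amult b (wordprod A [j, i])) j = E b i*E b j^2"
    "E (amult b (wordprod A [j, i, j])) i = E b i^2*E b j^3"
    "E (amult b (wordprod A [j, i, j, i])) j = E b i*E b j"
    "E (amult b (wordprod A [j, i, j, i, j])) i = E b i"
    using e[of "[]" j 0 1]
      e[of "[j]" i 1 3]
      e[of "[j, i]" j 1 2]
      e[of "[j, i, j]" i 2 3]
      e[of "[j, i, j, i]" j 1 1]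
      e[of "[j, i, j, i, j]" i 1 0]
    by (simp_all add: ws del: wordprod_Cons)
  have d: "g (amult b (wordprod A [j])) = g (amult b (wordprod A [])) + (1 - E b j) * Tr j g (amult b (wordprod A []))"
    "g (amult b (wordprod A [j, i])) = g (amult b (wordprod A [j])) + (1 - E b i*E b j^3) * Tr i g (amult b (wordprod A [j]))"
    "g (amult b (wordprod A [j, i, j])) = g (amult b (wordprod A [j, i])) + (1 - E b i*E b j^2) * Tr j g (amult b (wordprod A [j, i]))"
    "g (amult b (wordprod A [j, i, j, i])) = g (amult b (wordprod A [j, i, j])) + (1 - E b i^2*E b j^3) * Tr i g (amult b (wordprod A [j, i, j]))"
    "g (amult b (wordprod A [j, i, j, i, j])) = g (amult b (wordprod A [j, i, j, i])) + (1 - E b i*E b j) * Tr j g (amult b (wordprod A [j, i, j, i]))"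
    "g (amult b (wordprod A [j, i, j, i, j, i])) = g (amult b (wordprod A [j, i, j, i, j])) + (1 - E b i) * Tr i g (amult b (wordprod A [j, i, j, i, j]))" for g
    by (rule step_word[OF assms(2)], rule de, simp)+
  note nz = E_ne_1[OF affW_append[OF assms(2), of "[]"], of i, unfolded ce(1)]
    E_ne_1[OF affW_append[OF assms(2), of "[i]"], of j, unfolded ce(2)]
    E_ne_1[OF affW_append[OF assms(2), of "[i, j]"], of i, unfolded ce(3)]
    E_ne_1[OF affW_append[OF assms(2), of "[i, j, i]"], of j, unfolded ce(4)]
    E_ne_1[OF affW_append[OF assms(2), of "[i, j, i, j]"], of i, unfolded ce(5)]
    E_ne_1[OF affW_append[OF assms(2), of "[i, j, i, j, i]"], of j, unfolded ce(6)]
  have z: "amult b (wordprod A [j, i, j, i, j, i]) = amult b (wordprod A [i, j, i, j, i, j])"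
    using aff.ev_braid[OF assms(1)] assms(3,4)
    by (intro arg_cong[of _ _ "amult b"]) (simp add: wordprod_eq_iff aff.braid_order_def eval_nat_numeral del: wordprod_Cons)
  show ?thesis using yang_baxter_6[OF Tr_Tr Tr_uminus Tr_Tr Tr_uminus c d[unfolded z] nz, of f]
    by (simp add: eval_nat_numeral amult_one_right[OF assms(2)])
qed

text \<open>Types B2 and G2 were treated with i long; the opposite orientation is obtained by
  exchanging i and j.\<close>

lemma Tr_braid:
  assumes "i \<noteq> j"
  shows "foldr Tr (alt i j (aff.braid_order i j)) = foldr Tr (alt j i (aff.braid_order i j))"
proof (intro ext)
  fix f b
  show "foldr Tr (alt i j (aff.braid_order i j)) f b = foldr Tr (alt j i (aff.braid_order i j)) f b"
  proof (cases "b \<in> affW A")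
    case True
    note sym = assms[symmetric]
    show ?thesis using aff.offdiag[OF assms]
      Tr_braid_2[OF assms True] Tr_braid_3[OF assms True] Tr_braid_4[OF assms True] Tr_braid_6[OF assms True]
      Tr_braid_4[OF sym True] Tr_braid_6[OF sym True]
      by (auto simp: aff.braid_order_def simp del: alt.simps) simp
  next
    case False
    then show ?thesis by (cases "aff.braid_order i j") (simp_all add: Tr_outside)
  qed
qed

lemma Tr_matsumoto:
  assumes "aff.reduced us" "aff.reduced vs" "wordprod A us = wordprod A vs"
  shows "foldr Tr us = foldr Tr vs"
  by (rule aff.matsumoto[OF Tr_braid assms(1,2)]) (use assms(3) wordprod_eq_iff in blast)+

section \<open>Products of the \<open>T_v\<close> with a single generator\<close>

lemma redword:
  assumes "x \<in> affW A"
  shows "wordprod A (redword A x) = x" "length (redword A x) = len A x" "aff.reduced (redword A x)"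
proof -
  obtain ws where ws: "x = wordprod A ws" using assms affW_iff by blast
  obtain us where "ev Chat us = ev Chat ws" "length us = aff.word_len ws" using aff.word_len_ex by blast
  then have "wordprod A us = x \<and> length us = len A x" by (simp add: ws len_wordprod wordprod_eq_iff)
  then have "wordprod A (redword A x) = x \<and> length (redword A x) = len A x"
    unfolding redword_def by (rule someI)
  then show 1: "wordprod A (redword A x) = x" "length (redword A x) = len A x" by auto
  show "aff.reduced (redword A x)"
    unfolding aff.reduced_def using len_wordprod[of "redword A x"] 1 by simp
qed

lemma reduced_iff: "aff.reduced ws \<longleftrightarrow> len A (wordprod A ws) = length ws"
  by (simp add: aff.reduced_def len_wordprod)

lemma len_wordprod_le: "len A (wordprod A ws) \<le> length ws"
  unfolding len_wordprod by (rule aff.word_len_le) simp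

lemma len_right_cases:
  assumes "v \<in> affW A"
  shows "len A (amult v (agen A j)) = Suc (len A v) \<or> Suc (len A (amult v (agen A j))) = len A v"
proof -
  obtain ws where ws: "v = wordprod A ws" using assms affW_iff by blast
  have "amult v (agen A j) = wordprod A (ws @ [j])" by (simp add: ws wordprod_append lattice_linear_agen)
  then show ?thesis using aff.word_len_snoc_cases[of ws j] by (simp add: ws len_wordprod)
qed

lemma len_left_cases:
  assumes "v \<in> affW A"
  shows "len A (amult (agen A j) v) = Suc (len A v) \<or> Suc (len A (amult (agen A j) v)) = len A v"
proof -
  obtain ws where ws: "v = wordprod A ws" using assms affW_iff by blast
  have "amult (agen A j) v = wordprod A (j # ws)" by (simp add: ws)
  then show ?thesis using aff.word_len_Cons_cases[of j ws] by (simp add: ws len_wordprod del: wordprod_Cons)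
qed

lemma Tr_snoc_up:
  assumes "v \<in> affW A" "len A (amult v (agen A j)) = Suc (len A v)"
  shows "foldr Tr (redword A v) (Tr j f) = foldr Tr (redword A (amult v (agen A j))) f"
proof -
  have v': "amult v (agen A j) \<in> affW A" using assms(1) by (simp add: affW_mult)
  have p: "wordprod A (redword A v @ [j]) = amult v (agen A j)"
    by (simp add: wordprod_append lattice_linear_agen redword(1)[OF assms(1)])
  have "foldr Tr (redword A v @ [j]) = foldr Tr (redword A (amult v (agen A j)))"
    using p assms redword[OF assms(1)] redword[OF v'] by (intro Tr_matsumoto) (auto simp: reduced_iff)
  from fun_cong[OF this, of f] show ?thesis by simp
qed

text \<open>Here \<open>T_v\<close> factors as \<open>T_v'\<close> times \<open>T_j\<close> with v'
  the shorter element \<open>v s_j\<close>, and the square relation applies.\<close>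

lemma Tr_snoc_down:
  assumes "v \<in> affW A" "Suc (len A (amult v (agen A j))) = len A v"
  shows "foldr Tr (redword A v) (Tr j f) = (\<lambda>x. - foldr Tr (redword A v) f x)"
proof -
  define v' where "v' = amult v (agen A j)"
  have v': "v' \<in> affW A" using assms(1) by (simp add: affW_mult v'_def)
  have vv: "amult v' (agen A j) = v" by (simp add: v'_def amult_agen_agen assms(1))
  have up: "foldr Tr (redword A v') (Tr j g) = foldr Tr (redword A v) g" for g
    using Tr_snoc_up[OF v', of j g] assms(2) vv by (simp add: v'_def)
  have neg: "foldr Tr ws (\<lambda>x. - g x) = (\<lambda>x. - foldr Tr ws g x)" for ws g
    by (induction ws) (simp_all add: Tr_uminus)
  show ?thesis unfolding up[symmetric] Tr_Tr neg ..
qed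

lemma Tr_Cons_up:
  assumes "v \<in> affW A" "len A (amult (agen A j) v) = Suc (len A v)"
  shows "Tr j (foldr Tr (redword A v) f) = foldr Tr (redword A (amult (agen A j) v)) f"
proof -
  have v': "amult (agen A j) v \<in> affW A" using assms(1) by (simp add: affW_mult)
  have "foldr Tr (j # redword A v) = foldr Tr (redword A (amult (agen A j) v))"
    using assms redword[OF assms(1)] redword[OF v'] by (intro Tr_matsumoto) (auto simp: reduced_iff)
  from fun_cong[OF this, of f] show ?thesis by simp
qed

lemma Tr_Cons_down:
  assumes "v \<in> affW A" "Suc (len A (amult (agen A j) v)) = len A v"
  shows "Tr j (foldr Tr (redword A v) f) = (\<lambda>x. - foldr Tr (redword A v) f x)"
proof -
  define v' where "v' = amult (agen A j) v"
  have v': "v' \<in> affW A" using assms(1) by (simp add: affW_mult v'_def)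
  have vv: "amult (agen A j) v' = v" by (simp add: v'_def agen_agen_amult)
  have up: "Tr j (foldr Tr (redword A v') f) = foldr Tr (redword A v) f"
    using Tr_Cons_up[OF v', of j f] assms(2) vv by (simp add: v'_def)
  show ?thesis unfolding up[symmetric] Tr_Tr ..
qed

section \<open>The pairing with \<open>T_v\<close> and its dual basis\<close>

lemma foldr_Tr_lin: "foldr Tr ws (\<lambda>x. p * f x + q * g x) = (\<lambda>x. p * foldr Tr ws f x + q * foldr Tr ws g x)"
  by (induction ws) (simp_all add: Tr_lin)

lemma foldr_Tr_sum:
  assumes "finite S"
  shows "foldr Tr ws (\<lambda>x. \<Sum>y\<in>S. c y * g y x) = (\<lambda>x. \<Sum>y\<in>S. c y * foldr Tr ws (g y) x)"
  using assms
proof (induction S rule: finite_induct)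
  case empty
  show ?case using foldr_Tr_lin[of ws 0 undefined 0 undefined] by simp
next
  case (insert y S)
  then show ?case using foldr_Tr_lin[of ws "c y" "g y" 1 "\<lambda>x. \<Sum>y\<in>S. c y * g y x"] by simp
qed

text \<open>Started at the identity, the recursion visits only group elements, where
  \<open>Tact\<close> and \<open>Tr\<close> agree.\<close>

lemma pairT_eq: "pairT A v f = foldr Tr (redword A v) f aone"
proof -
  have "b \<in> affW A \<Longrightarrow> foldr (Tact A) ws f b = foldr Tr ws f b" for ws b
  proof (induction ws arbitrary: b)
    case (Cons j ws)
    then show ?case by (simp add: Tr_def Tact_def affW_mult)
  qed simp
  then show ?thesis by (simp add: pairT_def)
qed

lemma pairT_lin: "pairT A v (\<lambda>x. p * f x + q * g x) = p * pairT A v f + q * pairT A v g"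
  by (simp add: pairT_eq foldr_Tr_lin)

lemma pairT_diff: "pairT A v (\<lambda>x. f x - g x) = pairT A v f - pairT A v g"
  using pairT_lin[of v 1 f "-1" g] by simp

text \<open>Only the summand that moves at every letter survives, and a is the product of its
  nonzero factors 1/(1 - E). Vanishing is required along words from b, not by length, so that the
  base point can move in the induction.\<close>

lemma triangular_word:
  assumes "b \<in> affW A"
  shows "\<exists>a. a \<noteq> 0 \<and> (\<forall>f. (\<forall>us. length us < length ws \<longrightarrow> f (amult b (wordprod A us)) = 0)
           \<longrightarrow> foldr Tr ws f b = a * f (amult b (wordprod A ws)))"
  using assms
proof (induction ws arbitrary: b)
  case Nil
  then show ?case by (intro exI[of _ 1]) (simp add: amult_one_right)
next
  case (Cons j ws)
  note b = Cons.prems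
  have b': "amult b (agen A j) \<in> affW A" using b by (simp add: affW_mult)
  have assoc: "amult (amult b (agen A j)) x = amult b (amult (agen A j) x)" for x
    using b by (simp add: amult_assoc affW_lattice_linear)
  obtain a where a: "\<And>f. (\<And>us. length us < length ws \<Longrightarrow> f (amult b (wordprod A us)) = 0)
      \<Longrightarrow> foldr Tr ws f b = a * f (amult b (wordprod A ws))" using Cons.IH[OF b] by blast
  obtain a' where a': "a' \<noteq> 0" "\<And>f. (\<And>us. length us < length ws \<Longrightarrow> f (amult (amult b (agen A j)) (wordprod A us)) = 0)
      \<Longrightarrow> foldr Tr ws f (amult b (agen A j)) = a' * f (amult (amult b (agen A j)) (wordprod A ws))"
    using Cons.IH[OF b'] by blast
  have "foldr Tr (j # ws) f b = a' / (1 - E b j) * f (amult b (wordprod A (j # ws)))"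
    if f: "\<And>us. length us < length (j # ws) \<Longrightarrow> f (amult b (wordprod A us)) = 0" for f
  proof -
    have "foldr Tr ws f b = 0" using a[of f] f[of ws] f by simp
    moreover have "foldr Tr ws f (amult b (agen A j)) = a' * f (amult b (wordprod A (j # ws)))"
      using a'(2)[of f] f[of "j # _"] by (simp add: assoc)
    ultimately show ?thesis by (simp add: Tr_eq[OF b])
  qed
  then show ?case using a'(1) E_ne_1[OF b, of j] by (intro exI[of _ "a' / (1 - E b j)"]) auto
qed

lemma triangular:
  assumes "v \<in> affW A"
  shows "\<exists>a. a \<noteq> 0 \<and> (\<forall>f. (\<forall>x\<in>affW A. len A x < len A v \<longrightarrow> f x = 0) \<longrightarrow> pairT A v f = a * f v)"
proof -
  obtain a where a: "a \<noteq> 0" "\<And>f. (\<And>us. length us < length (redword A v) \<Longrightarrow> f (amult aone (wordprod A us)) = 0)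
           \<Longrightarrow> foldr Tr (redword A v) f aone = a * f (amult aone (wordprod A (redword A v)))"
    using triangular_word[OF affW_aone, of "redword A v"] by blast
  have "pairT A v f = a * f v" if "\<forall>x\<in>affW A. len A x < len A v \<longrightarrow> f x = 0" for f
  proof -
    have "foldr Tr (redword A v) f aone = a * f (amult aone (wordprod A (redword A v)))"
    proof (rule a(2))
      fix us :: "'n option list" assume "length us < length (redword A v)"
      then have "len A (wordprod A us) < len A v" using len_wordprod_le[of us] redword(2)[OF assms] by simp
      then show "f (amult aone (wordprod A us)) = 0" using that by simp
    qed
    then show ?thesis by (simp add: pairT_eq redword(1)[OF assms])
  qed
  then show ?thesis using a(1) by blast
qed

lemma pairT_zero_imp_zero:
  assumes "\<And>v. v \<in> affW A \<Longrightarrow> len A v \<le> N \<Longrightarrow> pairT A v f = 0" "v \<in> affW A" "len A v \<le> N"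
  shows "f v = 0"
  using assms(2,3)
proof (induction "len A v" arbitrary: v rule: less_induct)
  case less
  obtain a where a: "a \<noteq> 0" "\<And>f. (\<forall>x\<in>affW A. len A x < len A v \<longrightarrow> f x = 0) \<Longrightarrow> pairT A v f = a * f v"
    using triangular[OF less.prems(1)] by blast
  have "pairT A v f = a * f v" using less.hyps less.prems(2) by (intro a(2)) auto
  then show ?case using assms(1) less.prems a(1) by simp
qed

definition is_dual :: "'n aff \<Rightarrow> ('n aff \<Rightarrow> 'n frac) \<Rightarrow> bool" where
  "is_dual w f \<longleftrightarrow> (\<forall>b. b \<notin> affW A \<longrightarrow> f b = 0) \<and> (\<forall>v\<in>affW A. pairT A v f = (if v = w then 1 else 0))"

lemma pairT_ext:
  assumes "\<And>b. b \<notin> affW A \<Longrightarrow> f b = g b" "\<And>v. v \<in> affW A \<Longrightarrow> pairT A v f = pairT A v g"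
  shows "f = g"
proof
  fix b show "f b = g b"
  proof (cases "b \<in> affW A")
    case True
    have "f b - g b = 0"
      using assms(2) True by (intro pairT_zero_imp_zero[of "len A b" "\<lambda>x. f x - g x" b]) (simp_all add: pairT_diff)
    then show ?thesis by simp
  qed (simp add: assms(1))
qed

lemma dual_exists: "\<exists>f. is_dual w f"
proof -
  have "\<forall>v\<in>affW A. \<exists>a. a \<noteq> 0 \<and> (\<forall>f. (\<forall>x\<in>affW A. len A x < len A v \<longrightarrow> f x = 0) \<longrightarrow> pairT A v f = a * f v)"
    using triangular by blast
  then obtain a where a: "\<And>v. v \<in> affW A \<Longrightarrow> a v \<noteq> 0"
    "\<And>v f. v \<in> affW A \<Longrightarrow> (\<And>x. x \<in> affW A \<Longrightarrow> len A x < len A v \<Longrightarrow> f x = 0) \<Longrightarrow> pairT A v f = a v * f v"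
    by (metis (no_types, lifting) bchoice)
  \<comment> \<open>The triangular equation solved for the value at v. The recursion consults
    shorter elements only, so it is well founded on length, and the value 0 off the group is the one
    that \<open>is_dual\<close> prescribes.\<close>
  define F where "F = (\<lambda>(rec :: 'n aff \<Rightarrow> 'n frac) v. if v \<in> affW A
     then ((if v = w then 1 else 0) - pairT A v (\<lambda>x. if len A x < len A v then rec x else 0)) / a v else 0)"
  define f where "f = wfrec (Wellfounded.measure (len A)) F"
  have f: "f v = F f v" for v
  proof -
    have "f v = F (cut f (Wellfounded.measure (len A)) v) v" unfolding f_def by (rule wfrec) simp
    also have "\<dots> = F f v" unfolding F_def by (simp add: cut_def cong: if_cong)
    finally show ?thesis .
  qed
  have "pairT A v f = (if v = w then 1 else 0)" if v: "v \<in> affW A" for v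
  proof -
    define g where "g = (\<lambda>x. if len A x < len A v then f x else 0)"
    have fv: "f v = ((if v = w then 1 else 0) - pairT A v g) / a v"
      using f[of v] v by (simp add: F_def g_def)
    have "pairT A v (\<lambda>x. f x - g x) = a v * (f v - g v)"
      by (rule a(2)[OF v]) (simp add: g_def)
    also have "\<dots> = (if v = w then 1 else 0) - pairT A v g"
      using a(1)[OF v] by (simp add: fv g_def[THEN fun_cong])
    finally show ?thesis by (simp add: pairT_diff)
  qed
  then show ?thesis using f unfolding is_dual_def F_def by (intro exI[of _ f]) auto
qed

lemma schub_dual: "is_dual w (schub A w)"
proof -
  obtain f where f: "is_dual w f" using dual_exists by blast
  have "schub A w = f" unfolding schub_def is_dual_def[symmetric]
  proof (rule the_equality)
    show "is_dual w f" by (rule f)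
    show "g = f" if "is_dual w g" for g
      by (rule pairT_ext) (use f that in \<open>unfold is_dual_def, metis+\<close>)
  qed
  then show ?thesis using f by simp
qed

section \<open>The action of \<open>T_j\<close> on Schubert classes\<close>

lemma schub_outside: "b \<notin> affW A \<Longrightarrow> schub A w b = 0"
  using schub_dual unfolding is_dual_def by blast

lemma pairT_schub: "v \<in> affW A \<Longrightarrow> pairT A v (schub A w) = (if v = w then 1 else 0)"
  using schub_dual by (simp add: is_dual_def)

text \<open>Pairing \<open>T_v\<close> with \<open>T_j psi\<close> is pairing the product of
  \<open>T_v\<close> and \<open>T_j\<close> with psi, and that product is \<open>T_w\<close> for w =
  \<open>v s_j\<close>, or minus \<open>T_v\<close>.\<close>

lemma pairT_Tr_schub:
  assumes "v \<in> affW A"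
  shows "pairT A v (Tr j (schub A u)) =
    (if len A v < len A (amult v (agen A j)) then if amult v (agen A j) = u then 1 else 0
     else - (if v = u then 1 else 0))"
proof -
  have v': "amult v (agen A j) \<in> affW A" using assms by (simp add: affW_mult)
  show ?thesis
  proof (cases "len A (amult v (agen A j)) = Suc (len A v)")
    case True
    then show ?thesis using Tr_snoc_up[OF assms True, of "schub A u"] pairT_schub[OF v', of u]
      by (simp add: pairT_eq)
  next
    case False
    then have d: "Suc (len A (amult v (agen A j))) = len A v" using len_right_cases[OF assms] by blast
    then show ?thesis using Tr_snoc_down[OF assms d, of "schub A u"] pairT_schub[OF assms, of u]
      by (simp add: pairT_eq)
  qed
qed

lemma Tr_schub_ascent:
  assumes "u \<in> affW A" "len A u < len A (amult u (agen A j))"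
  shows "Tr j (schub A u) = (\<lambda>b. 0)"
proof (rule pairT_ext)
  show "Tr j (schub A u) b = 0" if "b \<notin> affW A" for b
    using that by (rule Tr_outside)
  fix v assume v: "v \<in> affW A"
  have "\<not> len A v < len A u" if "amult v (agen A j) = u"
    using assms(2) amult_agen_agen[OF v, of j] that by simp
  moreover have "len A v < len A (amult v (agen A j))" if "v = u"
    using assms(2) that by simp
  moreover have "u \<noteq> amult u (agen A j)" using assms(2) by force
  ultimately have "pairT A v (Tr j (schub A u)) = 0"
    unfolding pairT_Tr_schub[OF v] by (simp split: if_split)
  then show "pairT A v (Tr j (schub A u)) = pairT A v (\<lambda>b. 0)"
    using pairT_lin[of v 0 undefined 0 undefined] by simp
qed

lemma Tr_schub_descent:
  assumes "u \<in> affW A" "len A (amult u (agen A j)) < len A u"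
  shows "Tr j (schub A u) = (\<lambda>b. schub A (amult u (agen A j)) b - schub A u b)"
proof (rule pairT_ext)
  show "Tr j (schub A u) b = schub A (amult u (agen A j)) b - schub A u b" if "b \<notin> affW A" for b
    unfolding Tr_outside[OF that] schub_outside[OF that] by simp
  fix v assume v: "v \<in> affW A"
  have iff: "amult v (agen A j) = u \<longleftrightarrow> v = amult u (agen A j)"
    using amult_agen_agen[OF v, of j] amult_agen_agen[OF assms(1), of j] by metis
  have "len A v < len A (amult v (agen A j))" if "v = amult u (agen A j)"
    using assms(2) iff that by simp
  moreover have "\<not> len A v < len A (amult v (agen A j))" if "v = u"
    using assms(2) that by simp
  moreover have "u \<noteq> amult u (agen A j)" using assms(2) by force
  ultimately show "pairT A v (Tr j (schub A u)) = pairT A v (\<lambda>b. schub A (amult u (agen A j)) b - schub A u b)"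
    unfolding pairT_Tr_schub[OF v] pairT_diff pairT_schub[OF v] iff by (simp split: if_split)
qed

section \<open>Expansion in Schubert classes\<close>

lemma finite_len_le: "finite {y \<in> affW A. len A y \<le> N}"
proof -
  have "{y \<in> affW A. len A y \<le> N} \<subseteq> wordprod A ` {ws. set ws \<subseteq> UNIV \<and> length ws \<le> N}"
  proof (rule subsetI)
    fix y assume "y \<in> {y \<in> affW A. len A y \<le> N}"
    then have y: "y \<in> affW A \<and> len A y \<le> N" by (rule CollectD)
    then have r: "wordprod A (redword A y) = y" "length (redword A y) \<le> N" using redword[of y] by simp_all
    from imageI[of "redword A y" "{ws. set ws \<subseteq> UNIV \<and> length ws \<le> N}" "wordprod A"] r
    show "y \<in> wordprod A ` {ws. set ws \<subseteq> UNIV \<and> length ws \<le> N}" by simp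
  qed
  moreover have "finite {ws :: 'n option list. set ws \<subseteq> UNIV \<and> length ws \<le> N}"
    by (rule finite_lists_length_le) simp
  ultimately show ?thesis by (rule finite_subset[OF _ finite_imageI])
qed

text \<open>A general f has infinitely many nonzero coefficients. Truncating at N keeps the sum
  finite and does not disturb pairings up to length N, which determine the values up to that
  length.\<close>

lemma schubert_expansion:
  assumes "v \<in> affW A" "len A v \<le> N"
  shows "f v = (\<Sum>y\<in>{y \<in> affW A. len A y \<le> N}. pairT A y f * schub A y v)"
proof -
  define S where "S = {y \<in> affW A. len A y \<le> N}"
  have fin: "finite S" unfolding S_def by (rule finite_len_le)
  have "f v - (\<Sum>y\<in>S. pairT A y f * schub A y v) = 0"
  proof (rule pairT_zero_imp_zero[of N "\<lambda>v. f v - (\<Sum>y\<in>S. pairT A y f * schub A y v)"])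
    fix x assume x: "x \<in> affW A" "len A x \<le> N"
    have "pairT A x (\<lambda>v. \<Sum>y\<in>S. pairT A y f * schub A y v) = (\<Sum>y\<in>S. pairT A y f * pairT A x (schub A y))"
      unfolding pairT_eq[of x] foldr_Tr_sum[OF fin] ..
    also have "\<dots> = (\<Sum>y\<in>S. if x = y then pairT A y f else 0)"
      by (intro sum.cong) (auto simp: pairT_schub x)
    also have "\<dots> = pairT A x f" using fin x by (simp add: S_def)
    finally show "pairT A x (\<lambda>v. f v - (\<Sum>y\<in>S. pairT A y f * schub A y v)) = 0" by (simp add: pairT_diff)
  qed (use assms in auto)
  then show ?thesis by (simp add: S_def)
qed

text \<open>Right multiplication by s_i keeps y outside the finite group, and \<open>T_i\<close>
  sends the class of y to a combination of the classes of y and \<open>y s_i\<close>. Vanishing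
  therefore spreads from the identity over the finite group; it confines the second index in (3) to
  it.\<close>

lemma schub_weylW_zero:
  assumes "v \<in> weylW A" "y \<in> affW A" "y \<notin> weylW A"
  shows "schub A y v = 0"
  using assms
proof (induction arbitrary: y rule: weylW.induct)
  case one
  have "len A aone = 0" using len_wordprod_le[of "[]"] by simp
  then have "redword A aone = []" using redword(2)[OF affW_aone] by simp
  then have "pairT A aone (schub A y) = schub A y aone" by (simp add: pairT_eq)
  moreover have "y \<noteq> aone" using one weylW.one by auto
  ultimately show ?case using pairT_schub[OF affW_aone, of y] by simp
next
  case (step w i)
  have w: "w \<in> affW A" using step.hyps by (rule weylW_affW)
  have sg: "sgen A i = agen A (Some i)" by (simp add: agen_def)
  have y': "amult y (agen A (Some i)) \<in> affW A" using step.prems by (simp add: affW_mult)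
  have "amult y (agen A (Some i)) \<notin> weylW A"
  proof
    assume "amult y (agen A (Some i)) \<in> weylW A"
    then have "amult (amult y (agen A (Some i))) (sgen A i) \<in> weylW A" by (rule weylW.step)
    then show False using step.prems by (simp add: sg amult_agen_agen)
  qed
  then have 0: "schub A y w = 0" "schub A (amult y (agen A (Some i))) w = 0"
    using step.IH step.prems y' by auto
  have "Tr (Some i) (schub A y) w = 0"
  proof (cases "len A y < len A (amult y (agen A (Some i)))")
    case True
    then show ?thesis using Tr_schub_ascent[OF step.prems(1) True] by simp
  next
    case False
    then have "len A (amult y (agen A (Some i))) < len A y"
      using len_right_cases[OF step.prems(1), of "Some i"] by auto
    then show ?thesis using Tr_schub_descent[OF step.prems(1)] 0 by simp
  qed
  then show ?case using Tr_step[OF w, of "schub A y" "Some i"] 0 by (simp add: sg)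
qed

section \<open>The Demazure product and the expansion over a translation\<close>

definition dstep :: "'n option \<Rightarrow> 'n aff \<Rightarrow> 'n aff" where
  "dstep j v = (if len A v < len A (amult (agen A j) v) then amult (agen A j) v else v)"

lemma demazure_eq: "demazure A x y = foldr dstep (redword A x) y"
  unfolding demazure_def dstep_def[abs_def] ..

text \<open>A letter either raises the length of the product, without a sign, or is absorbed at the
  cost of -1; the exponent has the parity of the number of absorbed letters.\<close>

lemma dstep_word:
  assumes "y \<in> affW A"
  shows "foldr dstep ws y \<in> affW A" and "len A y \<le> len A (foldr dstep ws y)"
    and "foldr Tr ws (foldr Tr (redword A y) f) x
      = (- 1) ^ (length ws + len A y + len A (foldr dstep ws y)) * foldr Tr (redword A (foldr dstep ws y)) f x"
proof (induction ws arbitrary: x)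
  case Nil
  { case 1 then show ?case using assms by simp }
  { case 2 then show ?case by simp }
  { case 3 then show ?case by (simp flip: mult_2) }
next
  case (Cons j ws)
  define z where "z = foldr dstep ws y"
  define n where "n = length ws + len A y + len A z"
  note z = Cons(1)[folded z_def] and zlen = Cons(2)[folded z_def]
  have IH: "foldr Tr ws (foldr Tr (redword A y) f) = (\<lambda>x. (- 1) ^ n * foldr Tr (redword A z) f x)"
    using Cons(3) by (intro ext) (simp add: z_def n_def)
  have T: "foldr Tr (j # ws) (foldr Tr (redword A y) f) x = (- 1) ^ n * Tr j (foldr Tr (redword A z) f) x" for x
    using Tr_lin[of j "(-1)^n" "foldr Tr (redword A z) f" 0 "foldr Tr (redword A z) f"] by (simp add: IH)
  have f: "foldr dstep (j # ws) y = dstep j z" by (simp add: z_def)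
  { case 1 show ?case unfolding f using z by (simp add: dstep_def affW_mult) }
  { case 2 show ?case unfolding f using zlen by (simp add: dstep_def) }
  { case 3
    show ?case
    proof (cases "len A (amult (agen A j) z) = Suc (len A z)")
      case True
      then show ?thesis unfolding f T using Tr_Cons_up[OF z True, of f]
        by (simp add: dstep_def n_def)
    next
      case False
      then have d: "Suc (len A (amult (agen A j) z)) = len A z" using len_left_cases[OF z] by blast
      then show ?thesis unfolding f T using Tr_Cons_down[OF z d, of f]
        by (simp add: dstep_def n_def)
    qed }
qed

text \<open>\<open>demazure\<close> recurses through its left factor, which hides that the result is
  at least as long as that factor. Absorbing letters from the right exhibits the same operator as a
  multiple of \<open>T_r\<close> with r no shorter than x.\<close>

lemma Tr_right_absorb:
  assumes "x \<in> affW A"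
  shows "\<exists>r\<in>affW A. len A x \<le> len A r \<and> (\<exists>s. \<forall>f b. foldr Tr (redword A x) (foldr Tr ws f) b = s * foldr Tr (redword A r) f b)"
  using assms
proof (induction ws arbitrary: x)
  case Nil
  then show ?case by (intro bexI[of _ x] conjI exI[of _ 1]) simp_all
next
  case (Cons j ws)
  show ?case
  proof (cases "len A (amult x (agen A j)) = Suc (len A x)")
    case True
    have x': "amult x (agen A j) \<in> affW A" using Cons.prems by (simp add: affW_mult)
    obtain r s where r: "r \<in> affW A" "len A (amult x (agen A j)) \<le> len A r"
      "\<And>f b. foldr Tr (redword A (amult x (agen A j))) (foldr Tr ws f) b = s * foldr Tr (redword A r) f b"
      using Cons.IH[OF x'] by blast
    then show ?thesis using True Tr_snoc_up[OF Cons.prems True]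
      by (intro bexI[of _ r] conjI exI[of _ s]) simp_all
  next
    case False
    then have d: "Suc (len A (amult x (agen A j))) = len A x" using len_right_cases[OF Cons.prems] by blast
    obtain r s where r: "r \<in> affW A" "len A x \<le> len A r"
      "\<And>f b. foldr Tr (redword A x) (foldr Tr ws f) b = s * foldr Tr (redword A r) f b"
      using Cons.IH[OF Cons.prems] by blast
    then show ?thesis using Tr_snoc_down[OF Cons.prems d]
      by (intro bexI[of _ r] conjI exI[of _ "- s"]) simp_all
  qed
qed

lemma demazure_props:
  assumes "x \<in> affW A" "y \<in> affW A"
  shows "demazure A x y \<in> affW A" "len A y \<le> len A (demazure A x y)" "len A x \<le> len A (demazure A x y)"
    and "foldr Tr (redword A x) (foldr Tr (redword A y) f) b
      = (- 1) ^ (len A x + len A y + len A (demazure A x y)) * foldr Tr (redword A (demazure A x y)) f b"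
proof -
  define z where "z = demazure A x y"
  show z: "demazure A x y \<in> affW A" and "len A y \<le> len A (demazure A x y)"
    using dstep_word(1,2)[OF assms(2)] by (simp_all add: demazure_eq)
  show T: "foldr Tr (redword A x) (foldr Tr (redword A y) f) b
      = (- 1) ^ (len A x + len A y + len A (demazure A x y)) * foldr Tr (redword A (demazure A x y)) f b" for f b
    using dstep_word(3)[OF assms(2), of "redword A x" f b] by (simp add: demazure_eq redword(2)[OF assms(1)])
  obtain r s where r: "r \<in> affW A" "len A x \<le> len A r"
    "\<And>f b. foldr Tr (redword A x) (foldr Tr (redword A y) f) b = s * foldr Tr (redword A r) f b"
    using Tr_right_absorb[OF assms(1)] by blast
  \<comment> \<open>Testing both descriptions of the product on the class of z identifies r with
    z.\<close>
  have "s * pairT A r (schub A z) = (- 1) ^ (len A x + len A y + len A z) * pairT A z (schub A z)"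
    unfolding pairT_eq using T[of "schub A z" aone] r(3)[of "schub A z" aone] by (simp add: z_def)
  then have "pairT A r (schub A z) \<noteq> 0" using z by (auto simp: pairT_schub z_def)
  then have "r = z" using pairT_schub[OF r(1), of z] by (auto split: if_splits)
  then show "len A x \<le> len A (demazure A x y)" using r(2) by (simp add: z_def)
qed

lemma foldr_Tr_translate:
  assumes "t \<in> affW A" "fst t = id" "x \<in> affW A"
  shows "foldr Tr ws (\<lambda>x. f (amult t x)) x = foldr Tr ws f (amult t x)"
  using assms(3)
proof (induction ws arbitrary: x)
  case (Cons j ws)
  have "E (amult t x) j = E x j" by (simp add: E_def assms(2))
  then show ?case using Cons assms(1)
    by (simp add: Tr_eq affW_mult amult_assoc affW_lattice_linear)
qed simp

theorem schub_translation_formula: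
  assumes "t \<in> affW A" "fst t = id" "v \<in> weylW A" "w \<in> affW A"
  defines "Q \<equiv> {(x, y). x \<in> affW A \<and> y \<in> weylW A \<and> demazure A x y = w}"
  shows "schub A w (amult t v) = (\<Sum>(x, y)\<in>Q. (- 1) ^ (len A x + len A y + len A w) * schub A x t * schub A y v)"
proof -
  \<comment> \<open>Large enough for both expansions, at v and at t, and for every pair in Q, whose
    members are no longer than w. In particular Q is finite, so the sum over it is a genuine
    one.\<close>
  define N where "N = len A t + len A v + len A w"
  define S where "S = {y \<in> affW A. len A y \<le> N}"
  define h where "h = (\<lambda>x y. (- 1) ^ (len A x + len A y + len A w) * schub A x t * schub A y v)"
  have fin: "finite S" unfolding S_def by (rule finite_len_le)
  have v: "v \<in> affW A" using assms(3) by (rule weylW_affW)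
  have Q: "Q \<subseteq> S \<times> S"
  proof
    fix p assume "p \<in> Q"
    then obtain x y where p: "p = (x, y)" "x \<in> affW A" "y \<in> weylW A" "demazure A x y = w" by (auto simp: Q_def)
    have y: "y \<in> affW A" using p(3) by (rule weylW_affW)
    show "p \<in> S \<times> S" using demazure_props(2,3)[OF p(2) y] p y by (simp add: S_def N_def)
  qed
  have inner: "pairT A y (\<lambda>x. schub A w (amult t x))
      = (\<Sum>x\<in>S. (if demazure A x y = w then (- 1) ^ (len A x + len A y + len A w) else 0) * schub A x t)"
    if y: "y \<in> S" for y
  proof -
    have y': "y \<in> affW A" using y by (simp add: S_def)
    have "pairT A y (\<lambda>x. schub A w (amult t x)) = foldr Tr (redword A y) (schub A w) t"
      using foldr_Tr_translate[OF assms(1,2) affW_aone] by (simp add: pairT_eq amult_one_right[OF assms(1)])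
    also have "\<dots> = (\<Sum>x\<in>S. pairT A x (foldr Tr (redword A y) (schub A w)) * schub A x t)"
      unfolding S_def by (rule schubert_expansion) (simp_all add: assms(1) N_def)
    also have "\<dots> = (\<Sum>x\<in>S. (if demazure A x y = w then (- 1) ^ (len A x + len A y + len A w) else 0) * schub A x t)"
    proof (intro sum.cong refl arg_cong2[of _ _ _ _ "(*)"])
      fix x assume "x \<in> S"
      then have x: "x \<in> affW A" by (simp add: S_def)
      note D = demazure_props[OF x y']
      have "pairT A x (foldr Tr (redword A y) (schub A w))
          = (- 1) ^ (len A x + len A y + len A (demazure A x y)) * pairT A (demazure A x y) (schub A w)"
        unfolding pairT_eq by (rule D(4))
      then show "pairT A x (foldr Tr (redword A y) (schub A w))
          = (if demazure A x y = w then (- 1) ^ (len A x + len A y + len A w) else 0)"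
        by (simp add: pairT_schub D(1))
    qed
    finally show ?thesis .
  qed
  have "schub A w (amult t v) = (\<Sum>y\<in>S. pairT A y (\<lambda>x. schub A w (amult t x)) * schub A y v)"
    unfolding S_def by (rule schubert_expansion[of v N "\<lambda>x. schub A w (amult t x)"]) (simp_all add: v N_def)
  also have "\<dots> = (\<Sum>y\<in>S. \<Sum>x\<in>S. if demazure A x y = w then h x y else 0)"
    by (intro sum.cong refl) (simp add: inner sum_distrib_right h_def if_distrib[of "\<lambda>x. x * _"] cong: if_cong)
  also have "\<dots> = (\<Sum>x\<in>S. \<Sum>y\<in>S. if demazure A x y = w then h x y else 0)" by (rule sum.swap)
  also have "\<dots> = (\<Sum>(x, y)\<in>S \<times> S. if demazure A x y = w then h x y else 0)" by (rule sum.cartesian_product)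
  also have "\<dots> = (\<Sum>(x, y)\<in>Q. if demazure A x y = w then h x y else 0)"
  proof (rule sum.mono_neutral_right[OF _ Q])
    show "finite (S \<times> S)" using fin by simp
    show "\<forall>p\<in>S \<times> S - Q. (case p of (x, y) \<Rightarrow> if demazure A x y = w then h x y else 0) = 0"
    proof (rule ballI)
      fix p assume p: "p \<in> S \<times> S - Q"
      obtain x y where xy: "p = (x, y)" by (cases p)
      have xy': "x \<in> affW A" "y \<in> affW A" "(x, y) \<notin> Q" using p by (simp_all add: xy S_def)
      \<comment> \<open>Such a pair misses Q only because y lies outside the finite group, and then
        its class vanishes at v.\<close>
      have "h x y = 0" if "demazure A x y = w"
      proof -
        have "y \<notin> weylW A" using xy' that by (simp add: Q_def)
        then show ?thesis using schub_weylW_zero[OF assms(3) xy'(2)] by (simp add: h_def)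
      qed
      then show "(case p of (x, y) \<Rightarrow> if demazure A x y = w then h x y else 0) = 0" by (simp add: xy)
    qed
  qed
  also have "\<dots> = (\<Sum>(x, y)\<in>Q. h x y)"
  proof (rule sum.cong[OF refl])
    fix p assume p: "p \<in> Q"
    obtain x y where xy: "p = (x, y)" by (cases p)
    then show "(case p of (x, y) \<Rightarrow> if demazure A x y = w then h x y else 0) = (case p of (x, y) \<Rightarrow> h x y)"
      using p by (simp add: Q_def)
  qed
  finally show ?thesis unfolding h_def .
qed

section \<open>The identities (1) to (4)\<close>

lemma actR_echar: "actR b (echar l) = echar (fst b l)"
  by (simp add: actR_def echar_def)

text \<open>The support consists of 0 and l unless l = 0, when the element is zero; hence the case
  split.\<close>

lemma actR_one_minus:
  assumes "lattice_linear (fst b)"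
  shows "actR b (1 - echar l) = 1 - echar (fst b l)"
proof (cases "l = 0")
  case True
  then show ?thesis using lattice_linear_0[OF assms] by (simp add: actR_def)
next
  case False
  have lk: "Poly_Mapping.lookup (1 - echar l) k = (if k = 0 then 1 else if k = l then -1 else 0)" for k
    using False by (auto simp: lookup_minus echar_def lookup_one lookup_single when_def)
  have "Poly_Mapping.keys (1 - echar l) = {0, l}"
    by (auto simp: in_keys_iff lk set_eq_iff False split: if_splits)
  then have "actR b (1 - echar l) = Poly_Mapping.single (fst b 0) 1 + Poly_Mapping.single (fst b l) (- 1)"
    unfolding actR_def using False by (simp add: lk)
  then show ?thesis using lattice_linear_0[OF assms] by (simp add: echar_def single_uminus)
qed

theorem schubert_identities:
  assumes u: "u \<in> affW0 A"
  shows "b \<in> affW A \<Longrightarrow> eact (echar la) (schub A u) b = lineb la b * schub A u b"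
    and "b \<in> affW A \<Longrightarrow> yact A (Some i) (schub A u) b = schub A u b \<and> sact A (Some i) (schub A u) b = schub A u b"
    and "u \<noteq> aone \<Longrightarrow> b \<in> affW A \<Longrightarrow> yact A None (schub A u) b = schub A (amult u (szero A)) b"
    and "u \<noteq> aone \<Longrightarrow> b \<in> affW A \<Longrightarrow> schub A (amult u (szero A)) b =
            (\<Sum>(x1, x2)\<in>{(x1, x2). x1 \<in> affW A \<and> x2 \<in> weylW A \<and> demazure A x1 x2 = amult u (szero A)}.
               (- 1) powi (int (len A x1) + int (len A x2) - int (len A u) - 1)
               * thetaOp (schub A x1) b * etaOp (schub A x2) b)"
    and "u \<noteq> aone \<Longrightarrow> b \<in> affW A \<Longrightarrow> sact A None (schub A u) b =
            eact (echar (- highest_root A)) (schub A u) b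
          + (\<Sum>(x1, x2)\<in>{(x1, x2). x1 \<in> affW A \<and> x2 \<in> weylW A \<and> demazure A x1 x2 = amult u (szero A)}.
               (- 1) powi (int (len A x1) + int (len A x2) - int (len A u) - 1)
               * thetaOp (schub A x1) b
               * etaOp (eact (1 - echar (- highest_root A)) (schub A x2)) b)"
proof -
  have uW: "u \<in> affW A" and umin: "\<And>w. w \<in> weylW A \<Longrightarrow> len A u \<le> len A (amult u w)"
    using u by (auto simp: affW0_def)
  have sz: "szero A = agen A None" by (simp add: agen_def)
  have asc: "len A u < len A (amult u (agen A (Some i)))" for i
  proof -
    have "amult aone (sgen A i) \<in> weylW A" by (intro weylW.intros)
    then have "len A u \<le> len A (amult u (agen A (Some i)))" using umin[of "sgen A i"] by (simp add: agen_def)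
    then show ?thesis using len_right_cases[OF uW, of "Some i"] by linarith
  qed
  \<comment> \<open>A nontrivial element has a right descent, and minimality in the coset excludes
    every node of I.\<close>
  have desc: "Suc (len A (amult u (agen A None))) = len A u" if "u \<noteq> aone"
  proof -
    obtain us where us: "u = wordprod A us" using uW affW_iff by blast
    have "aff.word_len us \<noteq> 0"
    proof
      assume "aff.word_len us = 0"
      then have "redword A u = []" using redword(2)[OF uW] by (simp add: us len_wordprod)
      then show False using redword(1)[OF uW] that by simp
    qed
    then obtain j where j: "Suc (aff.word_len (us @ [j])) = aff.word_len us" by (rule aff.last_letter)
    have jl: "Suc (len A (amult u (agen A j))) = len A u"
      using j len_wordprod[of "us @ [j]"] len_wordprod[of us] by (simp add: us wordprod_append lattice_linear_agen)
    have "j = None"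
    proof (rule ccontr)
      assume "j \<noteq> None"
      then obtain i where "j = Some i" by blast
      then show False using jl asc[of i] by simp
    qed
    then show ?thesis using jl by simp
  qed
  show "eact (echar la) (schub A u) b = lineb la b * schub A u b" if "b \<in> affW A"
    by (simp add: eact_def lineb_def actR_echar)
  show "yact A (Some i) (schub A u) b = schub A u b \<and> sact A (Some i) (schub A u) b = schub A u b" if b: "b \<in> affW A"
  proof -
    have T: "Tr (Some i) (schub A u) b = 0" by (simp add: Tr_schub_ascent[OF uW asc])
    then have "Tact A (Some i) (schub A u) b = 0" using b by (simp add: Tr_def)
    then show ?thesis using Tr_step[OF b, of "schub A u" "Some i"] T by (simp add: yact_def sact_def)
  qed
  assume "u \<noteq> aone" and b: "b \<in> affW A"
  note d = desc[OF \<open>u \<noteq> aone\<close>]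
  define w where "w = amult u (szero A)"
  have w: "w \<in> affW A" unfolding w_def sz using uW by (simp add: affW_mult)
  have dl: "Suc (len A w) = len A u" using d by (simp add: w_def sz)
  have Tw: "Tr None (schub A u) b = schub A w b - schub A u b"
    using Tr_schub_descent[OF uW, of None] d by (simp add: w_def sz)
  show "yact A None (schub A u) b = schub A (amult u (szero A)) b"
    using Tw b by (simp add: yact_def Tr_def w_def)
  define Q where "Q = {(x1, x2). x1 \<in> affW A \<and> x2 \<in> weylW A \<and> demazure A x1 x2 = w}"
  \<comment> \<open>With b split into translation and finite part, the values at the two parts are
    those of \<open>thetaOp\<close> and \<open>etaOp\<close> at b.\<close>
  have sum: "schub A w b = (\<Sum>(x1, x2)\<in>Q. (- 1) powi (int (len A x1) + int (len A x2) - int (len A u) - 1)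
               * thetaOp (schub A x1) b * etaOp (schub A x2) b)"
    using schub_translation_formula[OF translation_part(1)[OF b] _ finite_part[OF b] w]
    by (simp add: translation_part(2)[OF b] Q_def thetaOp_def etaOp_def powi_sign[OF dl])
  then show "schub A (amult u (szero A)) b =
            (\<Sum>(x1, x2)\<in>{(x1, x2). x1 \<in> affW A \<and> x2 \<in> weylW A \<and> demazure A x1 x2 = amult u (szero A)}.
               (- 1) powi (int (len A x1) + int (len A x2) - int (len A u) - 1)
               * thetaOp (schub A x1) b * etaOp (schub A x2) b)"
    by (simp add: w_def Q_def)
  \<comment> \<open>The finite part of b acts on P as b itself does, so the factor is the same in
    every summand and can be taken out of the sum.\<close>
  have eta: "etaOp (eact (1 - echar (- highest_root A)) f) b = (1 - E b None) * etaOp f b" for f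
    using affW_lattice_linear(1)[OF b]
    by (simp add: etaOp_def eact_def actR_one_minus E_def aalpha_def fr_diff)
  have "(\<Sum>(x1, x2)\<in>Q. (- 1) powi (int (len A x1) + int (len A x2) - int (len A u) - 1)
               * thetaOp (schub A x1) b * etaOp (eact (1 - echar (- highest_root A)) (schub A x2)) b)
      = (1 - E b None) * schub A w b"
    unfolding sum sum_distrib_left eta by (intro sum.cong) auto
  \<comment> \<open>This is \<open>s_0 = 1 + (1 - e^{alpha_0}) T_0\<close> at b, with
    \<open>T_0\<close> of the class of u equal to the class of w minus the class of u.\<close>
  moreover have "sact A None (schub A u) b = E b None * schub A u b + (1 - E b None) * schub A w b"
    using Tr_step[OF b, of "schub A u" None] by (simp add: sact_def Tw algebra_simps)
  ultimately show "sact A None (schub A u) b =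
            eact (echar (- highest_root A)) (schub A u) b
          + (\<Sum>(x1, x2)\<in>{(x1, x2). x1 \<in> affW A \<and> x2 \<in> weylW A \<and> demazure A x1 x2 = amult u (szero A)}.
               (- 1) powi (int (len A x1) + int (len A x2) - int (len A u) - 1)
               * thetaOp (schub A x1) b
               * etaOp (eact (1 - echar (- highest_root A)) (schub A x2)) b)"
    by (simp add: eact_def actR_echar E_def aalpha_def w_def Q_def)
qed

end

theorem theorem4p15:
  fixes A :: "'n::{finite,linorder} \<Rightarrow> 'n \<Rightarrow> int" and la :: "'n lat" and u :: "'n aff"
  assumes "cartan_finite A" and "indecomposable A" and "u \<in> affW0 A"
  shows "(\<forall>b\<in>affW A. eact (echar la) (schub A u) b = lineb la b * schub A u b)
    \<and> (\<forall>i. \<forall>b\<in>affW A. yact A (Some i) (schub A u) b = schub A u b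
                      \<and> sact A (Some i) (schub A u) b = schub A u b)
    \<and> (u \<noteq> aone \<longrightarrow> (\<forall>b\<in>affW A.
          yact A None (schub A u) b = schub A (amult u (szero A)) b
        \<and> schub A (amult u (szero A)) b =
            (\<Sum>(x1, x2)\<in>{(x1, x2). x1 \<in> affW A \<and> x2 \<in> weylW A \<and> demazure A x1 x2 = amult u (szero A)}.
               (- 1) powi (int (len A x1) + int (len A x2) - int (len A u) - 1)
               * thetaOp (schub A x1) b * etaOp (schub A x2) b)))
    \<and> (u \<noteq> aone \<longrightarrow> (\<forall>b\<in>affW A.
          sact A None (schub A u) b =
            eact (echar (- highest_root A)) (schub A u) b
          + (\<Sum>(x1, x2)\<in>{(x1, x2). x1 \<in> affW A \<and> x2 \<in> weylW A \<and> demazure A x1 x2 = amult u (szero A)}.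
               (- 1) powi (int (len A x1) + int (len A x2) - int (len A u) - 1)
               * thetaOp (schub A x1) b
               * etaOp (eact (1 - echar (- highest_root A)) (schub A x2)) b)))"
proof -
  note cf = assms(1)[unfolded cartan_finite_def]
  obtain d :: "'n \<Rightarrow> real" where d: "(\<forall>i. d i > 0) \<and> (\<forall>i j. d i * A i j = d j * A j i)
      \<and> (\<forall>x::'n \<Rightarrow> real. (\<exists>i. x i \<noteq> 0) \<longrightarrow> (\<Sum>i\<in>UNIV. \<Sum>j\<in>UNIV. x i * d i * A i j * x j) > 0)"
    using cf[THEN conjunct2, THEN conjunct2, THEN conjunct2] by (rule exE)
  interpret cartan A d
  proof
    show "A i i = 2" for i by (rule cf[THEN conjunct1, THEN spec])
    show "A i j \<le> 0" if "i \<noteq> j" for i j using cf[THEN conjunct2, THEN conjunct1] that by iprover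
    show "A i j = 0 \<longleftrightarrow> A j i = 0" for i j using cf[THEN conjunct2, THEN conjunct2, THEN conjunct1] by iprover
    show "d i > 0" for i using d[THEN conjunct1] by (rule spec)
    show "d i * A i j = d j * A j i" for i j using d[THEN conjunct2, THEN conjunct1] by iprover
    show "(\<Sum>i\<in>UNIV. \<Sum>j\<in>UNIV. x i * d i * A i j * x j) > 0" if "x i \<noteq> 0" for x :: "'n \<Rightarrow> real" and i
      using d[THEN conjunct2, THEN conjunct2] that by iprover
    show "\<exists>i\<in>J. \<exists>j. j \<notin> J \<and> A i j \<noteq> 0" if "J \<noteq> {}" "J \<noteq> UNIV" for J
      using assms(2)[unfolded indecomposable_def, THEN spec, of J] that by iprover
  qed
  note main = schubert_identities[OF assms(3)]
  have 1: "\<forall>b\<in>affW A. eact (echar la) (schub A u) b = lineb la b * schub A u b"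
    by (rule ballI, rule main(1))
  have 2: "\<forall>i. \<forall>b\<in>affW A. yact A (Some i) (schub A u) b = schub A u b
      \<and> sact A (Some i) (schub A u) b = schub A u b"
    by (rule allI, rule ballI, rule main(2))
  show ?thesis
    by (rule conjI[OF 1], rule conjI[OF 2], rule conjI)
      (rule impI, rule ballI, (rule conjI)?, rule main(3-5), assumption, assumption, (rule main(3-5), assumption, assumption)?)+
qed

end
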